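(* Let $p$ be a prime, $s\geq 3$, let $K$ be one of $\mathbb Z$, $\mathbb Z_p$ (the $p$-adic integers) or $\mathbb Z_{(p)}$ (the localization of $\mathbb Z$ at $p$), and let $F$ be a field containing $K$. Let $G=C_{p^s}$ be the cyclic group of order $p^s$. Then the set of $K$-ranks $\operatorname{rank}_K M$ of indecomposable faithful $KC_{p^s}$-lattices $M$ for which there exists a $1$-cocycle $T:C_{p^s}\to \widehat M$ such that the group $\mathrm{Crys}(C_{p^s};M;T)$ is torsion-free is unbounded.
   Context: Standing conventions: $K$ is a commutative ring (here $\mathbb Z$, $\mathbb Z_p$ or $\mathbb Z_{(p)}$), $F$ a field containing $K$, $G$ a finite abelian group, and $M$ a $KG$-module that is free of finite rank over $K$ (a $KG$-lattice); $M$ is faithful if $G$ acts faithfully. Put $FM=F\otimes_K M$ (an $FG$-module containing $M$ as a full lattice) and $\widehat M=FM/M$ (quotient of additive groups), a $KG$-module via $g(x+M)=gx+M$. A $1$-cocycle is a map $T:G\to\widehat M$ with $T(gh)=gT(h)+T(g)$ for all $g,h\in G$; for cyclic $G=\langle a\rangle$ it is determined by $T(a)$ via $T(a^k)=(1+a+\dots+a^{k-1})T(a)$. $T$ is cohomologous to zero (a coboundary) if there is $x\in FM$ with $T(g)=(g-1)x+M$ for all $g\in G$; it is cohomologous to zero at an element $g$ if such $x$ exists for that $g$. Define $\mathrm{Crys}(G;M;T)=\{(g,x): g\in G,\ x\in FM,\ x+M=T(g)\}$ with multiplication $(g,x)(g',x')=(gg',\,g'x+x')$. A group is torsion-free if it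 has no nontrivial elements of finite order. *)

theory Defs
  imports Main "Jordan_Normal_Form.Matrix"
begin

definition zloc :: "nat \<Rightarrow> 'f::field_char_0 set" where
  "zloc p = {of_int a / of_int b | a b. \<not> int p dvd b}"

definition padic_ints :: "nat \<Rightarrow> (nat \<Rightarrow> int) set" where
  "padic_ints p = {x. \<forall>n. 0 \<le> x n \<and> x n < int p ^ n \<and> x (Suc n) mod (int p ^ n) = x n}"

definition padic_add :: "nat \<Rightarrow> (nat \<Rightarrow> int) \<Rightarrow> (nat \<Rightarrow> int) \<Rightarrow> (nat \<Rightarrow> int)" where
  "padic_add p x y = (\<lambda>n. (x n + y n) mod (int p ^ n))"

definition padic_mult :: "nat \<Rightarrow> (nat \<Rightarrow> int) \<Rightarrow> (nat \<Rightarrow> int) \<Rightarrow> (nat \<Rightarrow> int)" where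
  "padic_mult p x y = (\<lambda>n. (x n * y n) mod (int p ^ n))"

definition padic_one :: "nat \<Rightarrow> (nat \<Rightarrow> int)" where
  "padic_one p = (\<lambda>n. 1 mod (int p ^ n))"

definition is_padic_subring :: "nat \<Rightarrow> 'f::field_char_0 set \<Rightarrow> bool" where
  "is_padic_subring p K \<longleftrightarrow> (\<exists>h. bij_betw h (padic_ints p) K
      \<and> (\<forall>x\<in>padic_ints p. \<forall>y\<in>padic_ints p. h (padic_add p x y) = h x + h y
                                          \<and> h (padic_mult p x y) = h x * h y)
      \<and> h (padic_one p) = 1)"

(* ---------- KC_q-lattices in coordinates ----------
   M = K^n sitting inside FM = F^n; the generator a of C_q acts by the matrix A. *)

definition lat :: "'f::field set \<Rightarrow> nat \<Rightarrow> 'f vec set" where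
  "lat K n = {v \<in> carrier_vec n. \<forall>i<n. v $ i \<in> K}"

definition cyc_lattice :: "'f::field set \<Rightarrow> nat \<Rightarrow> nat \<Rightarrow> 'f mat \<Rightarrow> bool" where
  "cyc_lattice K q n A \<longleftrightarrow> A \<in> carrier_mat n n \<and> (\<forall>i<n. \<forall>j<n. A $$ (i,j) \<in> K)
      \<and> A ^\<^sub>m q = 1\<^sub>m n"

definition cyc_faithful :: "nat \<Rightarrow> nat \<Rightarrow> 'f::field mat \<Rightarrow> bool" where
  "cyc_faithful q n A \<longleftrightarrow> (\<forall>k. 0 < k \<and> k < q \<longrightarrow> A ^\<^sub>m k \<noteq> 1\<^sub>m n)"

definition kg_submod :: "'f::field set \<Rightarrow> nat \<Rightarrow> 'f mat \<Rightarrow> 'f vec set \<Rightarrow> bool" where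
  "kg_submod K n A N \<longleftrightarrow> N \<subseteq> lat K n \<and> 0\<^sub>v n \<in> N
     \<and> (\<forall>x\<in>N. \<forall>y\<in>N. x + y \<in> N) \<and> (\<forall>c\<in>K. \<forall>x\<in>N. c \<cdot>\<^sub>v x \<in> N)
     \<and> (\<forall>x\<in>N. A *\<^sub>v x \<in> N)"

definition indecomposable :: "'f::field set \<Rightarrow> nat \<Rightarrow> 'f mat \<Rightarrow> bool" where
  "indecomposable K n A \<longleftrightarrow> 0 < n \<and>
     \<not> (\<exists>N1 N2. kg_submod K n A N1 \<and> kg_submod K n A N2
          \<and> N1 \<noteq> {0\<^sub>v n} \<and> N2 \<noteq> {0\<^sub>v n} \<and> N1 \<inter> N2 = {0\<^sub>v n}
          \<and> {x + y | x y. x \<in> N1 \<and> y \<in> N2} = lat K n)"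

(* 1-cocycle T : C_q -> FM/M, T(a^k) = tau k + M (tau k a representative) *)
definition cocycle :: "'f::field set \<Rightarrow> nat \<Rightarrow> nat \<Rightarrow> 'f mat \<Rightarrow> (nat \<Rightarrow> 'f vec) \<Rightarrow> bool" where
  "cocycle K q n A tau \<longleftrightarrow> (\<forall>k<q. tau k \<in> carrier_vec n)
     \<and> (\<forall>k<q. \<forall>l<q. tau ((k + l) mod q) - (A ^\<^sub>m k *\<^sub>v tau l + tau k) \<in> lat K n)"

(* Crys(C_q; M; T): pairs (a^k, x) with x + M = T(a^k) *)
definition crys :: "'f::field set \<Rightarrow> nat \<Rightarrow> nat \<Rightarrow> (nat \<Rightarrow> 'f vec) \<Rightarrow> (nat \<times> 'f vec) set" where
  "crys K q n tau = {(k, x). k < q \<and> x \<in> carrier_vec n \<and> x - tau k \<in> lat K n}"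

definition crys_mult :: "nat \<Rightarrow> 'f::field mat \<Rightarrow> nat \<times> 'f vec \<Rightarrow> nat \<times> 'f vec \<Rightarrow> nat \<times> 'f vec" where
  "crys_mult q A e e' = ((fst e + fst e') mod q, A ^\<^sub>m (fst e') *\<^sub>v snd e + snd e')"

primrec crys_pow :: "nat \<Rightarrow> nat \<Rightarrow> 'f::field mat \<Rightarrow> nat \<times> 'f vec \<Rightarrow> nat \<Rightarrow> nat \<times> 'f vec" where
  "crys_pow q n A e 0 = (0, 0\<^sub>v n)"
| "crys_pow q n A e (Suc m) = crys_mult q A (crys_pow q n A e m) e"

definition crys_torsion_free :: "'f::field set \<Rightarrow> nat \<Rightarrow> nat \<Rightarrow> 'f mat \<Rightarrow> (nat \<Rightarrow> 'f vec) \<Rightarrow> bool" where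
  "crys_torsion_free K q n A tau \<longleftrightarrow> (\<forall>e\<in>crys K q n tau. \<forall>m>0.
       crys_pow q n A e m = (0, 0\<^sub>v n) \<longrightarrow> e = (0, 0\<^sub>v n))"

end

theory Submission
  imports Defs "HOL-Computational_Algebra.Polynomial" "HOL-Computational_Algebra.Primes"
    "HOL-Library.Function_Algebras"
begin

text \<open>
  Let \<open>R\<^sub>i = K[x]/\<Phi>(x)\<close> with \<open>\<Phi>\<close> the cyclotomic polynomial of order \<open>p\<^sup>i\<close>. Each \<open>R\<^sub>i\<close> has residue field
  \<open>K/pK\<close>, the field with \<open>p\<close> elements, on which \<open>x\<close> acts trivially. For the four levels \<open>0, 1, 2, s\<close> and a subspace \<open>V\<close> of
  the direct sum of four residue spaces, the tuples in the sum of the free \<open>R\<^sub>i\<close>-modules whose residues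
  lie in \<open>V\<close> form a lattice \<open>M\<close>; its endomorphisms reduce to endomorphisms of the four-subspace
  representation \<open>V\<close>. Taking for \<open>V\<close> the tuples \<open>(a, b, a + b', a + b'')\<close>, where \<open>b\<close> has \<open>n + 1\<close>
  entries and \<open>b'\<close>, \<open>b''\<close> omit the last and the first of them, these are scalars. An idempotent
  endomorphism of \<open>M\<close> is thus \<open>0\<close> or \<open>1\<close> modulo the radical, hence equal to \<open>0\<close> or \<open>1\<close>.

  For the cocycle take \<open>T(a\<^sup>k) = k m/p\<^sup>s\<close> with \<open>m = (p e, 0, 0, 0)\<close>, \<open>e\<close> a basis vector. It is not cohomologous to zero
  at the element of order \<open>p\<close>: this element is trivial on the levels \<open>0, 1, 2\<close>, so one would need
  an element \<open>(- e, 0, 0, v)\<close> of \<open>M\<close>, whose third entry contradicts the form of \<open>V\<close>.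
\<close>

section \<open>Subrings with residue field of order p\<close>

text \<open>What the three choices of \<open>K\<close> have in common. By \<open>residue_int\<close>
  the integers map onto \<open>K/pK\<close>; \<open>separated\<close> says that the p-adic topology
  of \<open>K\<close> is Hausdorff. The integers fit although they are not local.\<close>

locale adic_subring =
  fixes p :: nat and K :: "'f::field_char_0 set"
  assumes prime_p: "prime p"
    and one_closed: "1 \<in> K"
    and add_closed: "a \<in> K \<Longrightarrow> b \<in> K \<Longrightarrow> a + b \<in> K"
    and uminus_closed: "a \<in> K \<Longrightarrow> - a \<in> K"
    and mult_closed: "a \<in> K \<Longrightarrow> b \<in> K \<Longrightarrow> a * b \<in> K"
    and residue_int: "a \<in> K \<Longrightarrow> \<exists>c::int. \<exists>b\<in>K. a = of_int c + of_nat p * b"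
    and separated: "(\<And>k. \<exists>b\<in>K. a = of_nat p ^ k * b) \<Longrightarrow> a = 0"

section \<open>The three coefficient rings\<close>

lemma zero_if_all_powers_dvd:
  fixes c :: int
  assumes "prime p" "\<And>k. int p ^ k dvd c"
  shows "c = 0"
proof (rule ccontr)
  assume "c \<noteq> 0"
  \<comment> \<open>The exponent is |c| itself, because |c| < p^|c|.\<close>
  define m where "m = nat \<bar>c\<bar>"
  have "int p ^ m \<le> int m"
    using dvd_imp_le_int[OF \<open>c \<noteq> 0\<close> assms(2)[of m]] by (simp add: m_def)
  then have "p ^ m \<le> m" by (metis of_nat_le_iff of_nat_power)
  moreover have "m < p ^ m" using assms(1) prime_gt_1_nat by (intro power_gt_expt) auto
  ultimately show False by simp
qed

lemma adic_subring_Ints: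
  assumes "prime p"
  shows "adic_subring p (\<int> :: 'f::field_char_0 set)"
proof
  fix a :: 'f
  show "\<exists>c::int. \<exists>b\<in>\<int>. a = of_int c + of_nat p * b" if "a \<in> \<int>"
    using that by (auto elim!: Ints_cases intro!: bexI[of _ 0])
  assume *: "\<exists>b\<in>\<int>. a = of_nat p ^ k * b" for k
  from *[of 0] obtain c where c: "a = of_int c" by (auto elim!: Ints_cases)
  have "int p ^ k dvd c" for k
  proof -
    obtain b where "b \<in> \<int>" "a = of_nat p ^ k * b" using * by blast
    then obtain d where "a = of_nat p ^ k * of_int d" by (auto elim!: Ints_cases)
    then have "(of_int c :: 'f) = of_int (int p ^ k * d)" using c by simp
    then show ?thesis by (metis dvd_triv_left of_int_eq_iff)
  qed
  then show "a = 0" using c zero_if_all_powers_dvd[OF assms] by simp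
qed (simp_all add: assms)

lemma adic_subring_zloc:
  assumes p: "prime p"
  shows "adic_subring p (zloc p :: 'f::field_char_0 set)"
proof
  have pi: "prime (int p)" using p by simp
  have nz: "(of_int b :: 'f) \<noteq> 0" if "\<not> int p dvd b" for b using that by auto
  fix a b :: 'f
  show "1 \<in> (zloc p :: 'f set)"
    unfolding zloc_def using pi by (auto intro!: exI[of _ 1] simp: not_prime_unit)
  {
    assume "a \<in> zloc p"
    then obtain x y where a: "a = of_int x / of_int y" "\<not> int p dvd y" by (auto simp: zloc_def)
    show "- a \<in> zloc p"
      unfolding zloc_def using a by (intro CollectI exI[of _ "- x"] exI[of _ y]) simp
    have "coprime y (int p)" using prime_imp_coprime[OF pi a(2)] by (simp add: coprime_commute)
    then obtain u v where uv: "y * u + int p * v = 1"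
      by (metis bezout_int coprime_iff_gcd_eq_1 mult.commute)
    \<comment> \<open>Multiply the numerator by the Bezout relation y u + p v = 1.\<close>
    have "a = of_int (x * u) + of_nat p * (of_int (x * v) / of_int y)"
    proof -
      have "(of_int x :: 'f) = of_int (x * (y * u + int p * v))" by (simp add: uv)
      also have "\<dots> = of_int y * of_int (x * u) + of_nat p * of_int (x * v)"
        by (simp add: algebra_simps)
      finally show ?thesis using nz[OF a(2)] a(1) by (simp add: field_simps)
    qed
    moreover have "of_int (x * v) / of_int y \<in> (zloc p :: 'f set)"
      unfolding zloc_def using a(2) by (intro CollectI exI[of _ "x * v"] exI[of _ y]) simp
    ultimately show "\<exists>c::int. \<exists>b\<in>zloc p. a = of_int c + of_nat p * b" by blast
    {
      assume "b \<in> zloc p"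
      then obtain x' y' where b: "b = of_int x' / of_int y'" "\<not> int p dvd y'" by (auto simp: zloc_def)
      have yy: "\<not> int p dvd y * y'" using pi a b by (simp add: prime_dvd_mult_iff)
      show "a + b \<in> zloc p"
        unfolding zloc_def using a b yy nz
        by (intro CollectI exI[of _ "x * y' + x' * y"] exI[of _ "y * y'"]) (auto simp: add_frac_eq)
      show "a * b \<in> zloc p"
        unfolding zloc_def using a b yy
        by (intro CollectI exI[of _ "x * x'"] exI[of _ "y * y'"]) auto
    }
  }
  assume *: "\<exists>b\<in>zloc p. a = of_nat p ^ k * b" for k
  from *[of 0] obtain x y where a: "a = of_int x / of_int y" "\<not> int p dvd y"
    by (auto simp: zloc_def)
  have "int p ^ k dvd x" for k
  proof -
    obtain b where "b \<in> zloc p" "a = of_nat p ^ k * b" using * by blast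
    then obtain c d where d: "\<not> int p dvd d" "a = of_nat p ^ k * (of_int c / of_int d)"
      unfolding zloc_def by blast
    have "of_int x / of_int y = (of_nat p ^ k * of_int c) / (of_int d :: 'f)"
      using a(1) d(2) by simp
    then have "of_int x * of_int d = (of_nat p ^ k * of_int c) * (of_int y :: 'f)"
      using frac_eq_eq[OF nz[OF a(2)] nz[OF d(1)]] by blast
    then have "(of_int (x * d) :: 'f) = of_int (int p ^ k * (c * y))"
      by (simp add: mult.assoc)
    then have "int p ^ k dvd x * d" by (metis dvd_triv_left of_int_eq_iff)
    moreover have "coprime (int p ^ k) d"
      using pi d(1) by (simp add: prime_imp_coprime)
    ultimately show ?thesis by (simp add: coprime_dvd_mult_left_iff)
  qed
  then have "x = 0" by (rule zero_if_all_powers_dvd[OF p])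
  then show "a = 0" using a by simp
qed (rule p)

text \<open>Through \<open>h\<close> each element becomes a coherent sequence of residues modulo
  p^n, with \<open>cst c\<close> as the sequence of the integer c. The axioms are then read off the
  residues.\<close>

lemma adic_subring_padic:
  fixes K :: "'f::field_char_0 set"
  assumes p: "prime p" and "is_padic_subring p K"
  shows "adic_subring p K"
proof -
  obtain h where bij: "bij_betw h (padic_ints p) K"
    and hadd: "\<And>x y. x \<in> padic_ints p \<Longrightarrow> y \<in> padic_ints p \<Longrightarrow> h (padic_add p x y) = h x + h y"
    and hmult: "\<And>x y. x \<in> padic_ints p \<Longrightarrow> y \<in> padic_ints p \<Longrightarrow> h (padic_mult p x y) = h x * h y"
    and hone: "h (padic_one p) = 1"
    using assms(2) unfolding is_padic_subring_def by blast
  have p0: "int p > 0" and p1: "int p > 1" using p prime_gt_1_nat[of p] by auto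
  have mod_in: "(\<lambda>n. g n mod int p ^ n) \<in> padic_ints p"
    if "\<And>n. g (Suc n) mod int p ^ n = g n mod int p ^ n" for g
    unfolding padic_ints_def using p0 that by (simp add: mod_mod_cancel)
  have coh: "x (Suc n) mod int p ^ n = x n mod int p ^ n" and red: "x n mod int p ^ n = x n"
    if "x \<in> padic_ints p" for x n
    using that unfolding padic_ints_def by auto
  have K_iff: "a \<in> K \<longleftrightarrow> (\<exists>x\<in>padic_ints p. a = h x)" for a
    using bij by (auto simp: bij_betw_def)
  have addI: "padic_add p x y \<in> padic_ints p" if "x \<in> padic_ints p" "y \<in> padic_ints p" for x y
    unfolding padic_add_def using coh that by (intro mod_in) (metis mod_add_eq)
  have multI: "padic_mult p x y \<in> padic_ints p" if "x \<in> padic_ints p" "y \<in> padic_ints p" for x y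
    unfolding padic_mult_def using coh that by (intro mod_in) (metis mod_mult_eq)
  define cst where "cst c = (\<lambda>n. c mod int p ^ n)" for c
  have cstI: "cst c \<in> padic_ints p" for c unfolding cst_def by (rule mod_in) simp
  have cst1: "h (cst 1) = 1" using hone by (simp add: cst_def padic_one_def)
  have cst_add: "h (cst (c + d)) = h (cst c) + h (cst d)" for c d
    using hadd[OF cstI cstI, of c d] by (simp add: padic_add_def cst_def mod_simps)
  have cst0: "h (cst 0) = 0" using cst_add[of 0 0] by simp
  have cst_nat: "h (cst (int c)) = of_nat c" for c
  proof (induction c)
    case (Suc c)
    have "h (cst (int (Suc c))) = h (cst (1 + int c))" by simp
    then show ?case using Suc cst_add[of 1 "int c"] cst1 by simp
  qed (simp add: cst0)
  show ?thesis
  proof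
    fix a b :: 'f
    show "1 \<in> K" using K_iff cst1 cstI by metis
    {
      assume "a \<in> K"
      then obtain x where x: "x \<in> padic_ints p" "a = h x" using K_iff by auto
      define y where "y = (\<lambda>n. (- x n) mod int p ^ n)"
      have y: "y \<in> padic_ints p"
        unfolding y_def using coh[OF x(1)] by (intro mod_in) (metis mod_minus_eq)
      have "padic_add p x y = cst 0"
        unfolding padic_add_def y_def cst_def by (simp add: mod_simps)
      then have "h x + h y = 0" using hadd[OF x(1) y] cst0 by simp
      then have "- a = h y" using x by (simp add: minus_unique)
      then show "- a \<in> K" using K_iff y by auto
      \<comment> \<open>\<open>z\<close> is (x - x_1)/p. Dividing a residue modulo p^(n+1) by p
        leaves one modulo p^n, hence the index shift.\<close>
      define z where "z = (\<lambda>n. (x (Suc n) div int p) mod int p ^ n)"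
      have shift: "c mod int p ^ Suc n div int p = c div int p mod int p ^ n" for c n
        using p0 by (simp add: zmod_zmult2_eq)
      have z: "z \<in> padic_ints p"
        unfolding z_def
      proof (rule mod_in)
        fix n
        have "x (Suc (Suc n)) mod int p ^ Suc n = x (Suc n) mod int p ^ Suc n"
          using coh[OF x(1)] .
        then have "x (Suc (Suc n)) mod int p ^ Suc n div int p = x (Suc n) mod int p ^ Suc n div int p"
          by simp
        then show "x (Suc (Suc n)) div int p mod int p ^ n = x (Suc n) div int p mod int p ^ n"
          by (simp only: shift)
      qed
      have x1: "x (Suc n) mod int p = x 1" for n
      proof (induction n)
        case 0
        show ?case using red[OF x(1), of 1] by simp
      next
        case (Suc n)
        have "x (Suc (Suc n)) mod int p = x (Suc (Suc n)) mod int p ^ Suc n mod int p"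
          by (simp add: mod_mod_cancel)
        also have "\<dots> = x (Suc n) mod int p" using coh[OF x(1)] red[OF x(1)] by metis
        finally show ?case using Suc by simp
      qed
      have "x = padic_add p (cst (x 1)) (padic_mult p (cst (int p)) z)"
      proof
        fix n
        have "padic_add p (cst (x 1)) (padic_mult p (cst (int p)) z) n
            = (x 1 + int p * (x (Suc n) div int p)) mod int p ^ n"
          unfolding padic_add_def padic_mult_def cst_def z_def by (simp add: mod_simps)
        also have "\<dots> = x (Suc n) mod int p ^ n"
          by (metis x1 mod_mult_div_eq)
        also have "\<dots> = x n" using coh[OF x(1)] red[OF x(1)] by simp
        finally show "x n = padic_add p (cst (x 1)) (padic_mult p (cst (int p)) z) n" ..
      qed
      then have "a = h (cst (x 1)) + h (cst (int p)) * h z"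
        using hadd[OF cstI multI[OF cstI z]] hmult[OF cstI z] x(2) by metis
      moreover have "x 1 = int (nat (x 1))" using x(1) unfolding padic_ints_def by simp
      ultimately have "a = of_int (x 1) + of_nat p * h z"
        using cst_nat by (metis of_int_of_nat_eq)
      then show "\<exists>c::int. \<exists>b\<in>K. a = of_int c + of_nat p * b" using K_iff z by blast
      {
        assume "b \<in> K"
        then show "a + b \<in> K" "a * b \<in> K"
          using x K_iff hadd hmult addI multI by metis+
      }
    }
    assume *: "\<exists>b\<in>K. a = of_nat p ^ k * b" for k
    from *[of 0] obtain x where x: "x \<in> padic_ints p" "a = h x" using K_iff by auto
    \<comment> \<open>An element of the form p^k y has k-th residue 0.\<close>
    have "x k = 0" for k
    proof -
      obtain y where y: "y \<in> padic_ints p" "a = of_nat p ^ k * h y" using * K_iff by metis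
      then have "h x = h (padic_mult p (cst (int (p ^ k))) y)"
        using x hmult[OF cstI y(1)] cst_nat[of "p ^ k"] by simp
      then have "x = padic_mult p (cst (int (p ^ k))) y"
        using bij x(1) multI[OF cstI y(1)] by (auto simp: bij_betw_def inj_on_def)
      then show ?thesis by (simp add: padic_mult_def cst_def)
    qed
    then have "x = cst 0" by (auto simp: cst_def)
    then show "a = 0" using x cst0 by simp
  qed (use p in auto)
qed

section \<open>The ideal \<open>pK\<close> and its residue field\<close>

context adic_subring
begin

lemma p_pos [simp]: "p > 0"
  using prime_p by (simp add: prime_gt_0_nat)

lemma p_nonzero [simp]: "p \<noteq> 0"
  using p_pos by simp

lemma zero_closed: "0 \<in> K"
  using add_closed[OF one_closed uminus_closed[OF one_closed]] by simp

lemma diff_closed: "a \<in> K \<Longrightarrow> b \<in> K \<Longrightarrow> a - b \<in> K"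
  using add_closed uminus_closed by fastforce

lemma of_nat_closed: "of_nat c \<in> K"
  by (induction c) (auto intro: zero_closed one_closed add_closed)

lemma of_int_closed: "of_int c \<in> K"
  by (cases c rule: int_cases2) (auto intro: of_nat_closed uminus_closed)

lemma sum_closed: "(\<And>i. i \<in> S \<Longrightarrow> f i \<in> K) \<Longrightarrow> sum f S \<in> K"
  by (induction S rule: infinite_finite_induct) (auto intro: zero_closed add_closed)

definition pK :: "'f set" where
  "pK = (*) (of_nat p) ` K"

lemma pK_subset: "a \<in> pK \<Longrightarrow> a \<in> K"
  unfolding pK_def using mult_closed of_nat_closed by auto

lemma pK_iff: "a \<in> pK \<longleftrightarrow> a / of_nat p \<in> K"
proof
  assume "a / of_nat p \<in> K"
  then show "a \<in> pK" unfolding pK_def by (intro image_eqI[of _ _ "a / of_nat p"]) auto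
qed (auto simp: pK_def)

lemma pK_zero: "0 \<in> pK"
  by (simp add: pK_iff zero_closed)

lemma pK_p: "of_nat p \<in> pK"
  by (simp add: pK_iff one_closed)

lemma pK_add: "a \<in> pK \<Longrightarrow> b \<in> pK \<Longrightarrow> a + b \<in> pK"
  by (simp add: pK_iff add_divide_distrib add_closed)

lemma pK_diff: "a \<in> pK \<Longrightarrow> b \<in> pK \<Longrightarrow> a - b \<in> pK"
  by (simp add: pK_iff diff_divide_distrib diff_closed)

lemma pK_mult: "a \<in> K \<Longrightarrow> b \<in> pK \<Longrightarrow> a * b \<in> pK"
  by (simp add: pK_iff mult_closed flip: times_divide_eq_right)

text \<open>If 1/p were in \<open>K\<close>, so would be all its powers, and 1 would be divisible by
  every p^k, against \<open>separated\<close>.\<close>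

lemma one_notin_pK: "1 \<notin> pK"
proof
  assume "1 \<in> pK"
  then have inv: "1 / of_nat p \<in> K" by (simp add: pK_iff)
  have "(1 / of_nat p) ^ k \<in> K" for k
    by (induction k) (use mult_closed[OF inv] in \<open>auto intro: one_closed\<close>)
  then have "\<exists>b\<in>K. 1 = of_nat p ^ k * b" for k
    by (intro bexI[of _ "(1 / of_nat p) ^ k"]) (auto simp: field_simps)
  then show False using separated[of 1] by auto
qed

text \<open>A Bezout relation between p and an integer prime to p would otherwise put 1 into
  \<open>pK\<close>.\<close>

lemma of_int_pK_iff: "of_int c \<in> pK \<longleftrightarrow> int p dvd c"
proof
  assume "int p dvd c"
  then obtain d where "c = int p * d" by blast
  then show "of_int c \<in> pK" by (simp add: pK_iff of_int_closed)
next
  assume c: "of_int c \<in> pK"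
  show "int p dvd c"
  proof (rule ccontr)
    assume "\<not> int p dvd c"
    then have "coprime c (int p)" using prime_imp_coprime[of "int p" c] prime_p by (simp add: coprime_commute)
    then obtain u v where uv: "u * c + v * int p = 1"
      by (metis bezout_int coprime_iff_gcd_eq_1)
    have "of_int u * of_int c + of_int v * of_nat p \<in> pK"
      by (intro pK_add pK_mult of_int_closed c pK_p)
    moreover have "of_int u * of_int c + of_int v * of_nat p = (of_int (u * c + v * int p) :: 'f)"
      by simp
    ultimately show False using uv one_notin_pK by simp
  qed
qed

text \<open>Modulo p the element is an integer c, and p dividing c(c - 1) leaves only the residues 0
  and 1.\<close>

lemma idempotent_mod_p:
  assumes "a \<in> K" "a * a - a \<in> pK"
  shows "a \<in> pK \<or> 1 - a \<in> pK"
proof -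
  obtain c b where b: "b \<in> K" "a = of_int c + of_nat p * b" using residue_int assms(1) by blast
  have d: "a - of_int c \<in> pK" using b by (simp add: pK_iff)
  have "of_int (c * (c - 1)) = (a * a - a) - (a + of_int c - 1) * (a - of_int c)"
    by (simp add: algebra_simps)
  also have "\<dots> \<in> pK"
    by (intro pK_diff pK_mult assms d diff_closed add_closed of_int_closed one_closed)
  finally have "int p dvd c * (c - 1)" by (simp only: of_int_pK_iff)
  then have "int p dvd c \<or> int p dvd c - 1" using prime_p by (simp add: prime_dvd_mult_iff)
  then show ?thesis
  proof
    assume "int p dvd c"
    then have "of_int c \<in> pK" by (simp add: of_int_pK_iff)
    from pK_add[OF d this] show ?thesis by simp
  next
    assume "int p dvd c - 1"
    then have "of_int (c - 1) \<in> pK" by (simp only: of_int_pK_iff)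
    from pK_add[OF d this] have "a - 1 \<in> pK" by (simp add: algebra_simps)
    from pK_diff[OF pK_zero this] show ?thesis by simp
  qed
qed

section \<open>Polynomials with coefficients in \<open>K\<close>\<close>

definition polys_over :: "'f poly set" where
  "polys_over = {f. \<forall>k. coeff f k \<in> K}"

lemma polys_over_0: "0 \<in> polys_over"
  by (simp add: polys_over_def zero_closed)

lemma polys_over_pCons: "pCons a f \<in> polys_over \<longleftrightarrow> a \<in> K \<and> f \<in> polys_over"
  by (auto simp: polys_over_def coeff_pCons split: nat.splits)

lemma polys_over_add: "f \<in> polys_over \<Longrightarrow> g \<in> polys_over \<Longrightarrow> f + g \<in> polys_over"
  by (simp add: polys_over_def add_closed)

lemma polys_over_diff: "f \<in> polys_over \<Longrightarrow> g \<in> polys_over \<Longrightarrow> f - g \<in> polys_over"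
  by (simp add: polys_over_def diff_closed)

lemma polys_over_smult: "c \<in> K \<Longrightarrow> f \<in> polys_over \<Longrightarrow> smult c f \<in> polys_over"
  by (simp add: polys_over_def mult_closed)

lemma polys_over_mult: "f \<in> polys_over \<Longrightarrow> g \<in> polys_over \<Longrightarrow> f * g \<in> polys_over"
  by (auto simp: polys_over_def coeff_mult intro!: sum_closed mult_closed)

lemma polys_over_power: "f \<in> polys_over \<Longrightarrow> f ^ m \<in> polys_over"
  by (induction m) (auto intro: polys_over_mult simp: one_pCons polys_over_pCons polys_over_0 one_closed)

lemma polys_over_sum: "(\<And>i. i \<in> S \<Longrightarrow> f i \<in> polys_over) \<Longrightarrow> sum f S \<in> polys_over"
  by (simp add: polys_over_def coeff_sum sum_closed)

text \<open>Division by a monic polynomial creates no denominators.\<close>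

lemma polys_over_mod:
  assumes f: "f \<in> polys_over" and g: "g \<in> polys_over" "lead_coeff g = 1"
  shows "f mod g \<in> polys_over"
  using f
proof (induction f)
  case 0
  then show ?case by (simp add: polys_over_0)
next
  case (pCons a f)
  have "g \<noteq> 0" using g(2) by auto
  then show ?case
    using pCons g unfolding mod_pCons[OF \<open>g \<noteq> 0\<close>]
    by (auto simp: polys_over_pCons polys_over_def coeff_pCons split: nat.splits
        intro!: polys_over_diff polys_over_smult zero_closed mult_closed diff_closed)
qed

text \<open>The inner binomial coefficients of a prime power are divisible by p. On a lattice where
  1 + t has order dividing p^s, this makes t nilpotent modulo p.\<close>

lemma power_one_plus_X_mod_p:
  fixes s :: nat
  shows "\<exists>g\<in>polys_over. [:1, 1:] ^ (p ^ s) = 1 + [:0, 1:] ^ (p ^ s) + smult (of_nat p) g"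
proof -
  let ?q = "p ^ s"
  have dvd: "p dvd (?q choose k)" if "0 < k" "k < ?q" for k
  proof (rule ccontr)
    assume "\<not> p dvd (?q choose k)"
    \<comment> \<open>With k C(q,k) = q C(q-1,k-1) coprimality forces q to divide k, which is too
      small.\<close>
    then have "coprime ?q (?q choose k)" using prime_p by (simp add: prime_imp_coprime)
    moreover have "?q dvd k * (?q choose k)"
      using times_binomial_minus1_eq[OF that(1), of ?q] by simp
    ultimately have "?q dvd k" by (simp add: coprime_dvd_mult_left_iff)
    then show False using that by (simp add: nat_dvd_not_less)
  qed
  have X_power: "[:0, 1:] ^ m = (monom 1 m :: 'f poly)" for m
    by (induction m) (simp_all add: monom_Suc one_pCons monom_0)
  define g :: "'f poly" where "g = (\<Sum>k\<in>{0<..<?q}. monom (of_nat ((?q choose k) div p)) k)"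
  have cg: "coeff g k = (if 0 < k \<and> k < ?q then of_nat ((?q choose k) div p) else 0)" for k
    unfolding g_def by (simp add: coeff_sum)
  have q0: "?q > 0" using prime_p prime_gt_0_nat by simp
  have "[:1, 1:] ^ ?q = 1 + [:0, 1:] ^ ?q + smult (of_nat p) g"
  proof (rule poly_eqI)
    fix k
    have "(of_nat p :: 'f) * of_nat ((?q choose k) div p) = of_nat (?q choose k)"
      if "0 < k" "k < ?q"
      using dvd[OF that] by (metis dvd_mult_div_cancel of_nat_mult)
    then show "coeff ([:1, 1:] ^ ?q :: 'f poly) k = coeff (1 + [:0, 1:] ^ ?q + smult (of_nat p) g) k"
      using q0 by (auto simp: coeff_linear_poly_power cg coeff_1 not_less binomial_eq_0 le_less X_power
          coeff_eq_0 degree_linear_power)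
  qed
  moreover have "g \<in> polys_over" by (auto simp: polys_over_def cg zero_closed of_nat_closed)
  ultimately show ?thesis by blast
qed

end

section \<open>Cyclotomic polynomials\<close>

text \<open>Cyclotomic polynomials of prime power order, in the variable \<open>t = x - 1\<close>.\<close>

primrec shifted_cyclotomic :: "nat \<Rightarrow> nat \<Rightarrow> 'a::field_char_0 poly" where
  "shifted_cyclotomic p 0 = [:0, 1:]"
| "shifted_cyclotomic p (Suc i) = (\<Sum>m<p. [:1, 1:] ^ (m * p ^ i))"

lemma shifted_cyclotomic_telescope:
  "([:1, 1:] ^ p ^ i - 1) * shifted_cyclotomic p (Suc i) = [:1, 1:] ^ p ^ Suc i - (1 :: 'a::field_char_0 poly)"
proof -
  have "([:1, 1:] ^ p ^ i - 1) * (\<Sum>m<p. ([:1, 1:] ^ p ^ i) ^ m) = ([:1, 1:] ^ p ^ i) ^ p - (1 :: 'a poly)"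
    by (rule power_diff_1_eq[symmetric])
  then show ?thesis by (simp add: power_mult[symmetric] mult.commute)
qed

lemma shifted_cyclotomic_dvd:
  assumes "i \<le> j"
  shows "shifted_cyclotomic p i dvd [:1, 1:] ^ p ^ j - (1 :: 'a::field_char_0 poly)"
  using assms
proof (induction j)
  case 0
  then show ?case by (simp add: one_pCons)
next
  case (Suc j)
  show ?case
  proof (cases "i = Suc j")
    case True
    then show ?thesis using shifted_cyclotomic_telescope by (metis dvd_triv_right)
  next
    case False
    then show ?thesis using Suc shifted_cyclotomic_telescope by (metis dvd_mult2 le_SucE)
  qed
qed

text \<open>For positive index the telescoping identity exhibits the polynomial as a quotient of two
  monic ones.\<close>

lemma lead_coeff_shifted_cyclotomic:
  assumes "p > 0"
  shows "lead_coeff (shifted_cyclotomic p i :: 'a::field_char_0 poly) = 1"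
proof (cases i)
  case (Suc j)
  have lc: "lead_coeff ([:1, 1:] ^ k - 1 :: 'a poly) = 1" if "k > 0" for k
  proof -
    have "degree ([:1, 1:] ^ k :: 'a poly) = k" by (simp add: degree_linear_power)
    moreover have "lead_coeff ([:1, 1:] ^ k :: 'a poly) = 1" by (simp add: lead_coeff_power)
    moreover from calculation have "degree ([:1, 1:] ^ k - 1 :: 'a poly) = k"
      using that by (metis degree_1 degree_add_eq_left degree_minus uminus_add_conv_diff add.commute)
    ultimately show ?thesis using that by (simp add: coeff_1)
  qed
  have "lead_coeff (([:1, 1:] ^ p ^ j - 1) * shifted_cyclotomic p (Suc j) :: 'a poly) = 1"
    unfolding shifted_cyclotomic_telescope using assms by (intro lc) simp
  then show ?thesis using assms lc[of "p ^ j"] Suc by (simp add: lead_coeff_mult del: shifted_cyclotomic.simps)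
qed simp

lemma coeff_0_shifted_cyclotomic:
  "coeff (shifted_cyclotomic p (Suc i) :: 'a::field_char_0 poly) 0 = of_nat p"
  by (simp add: coeff_sum coeff_0_power)

text \<open>Each of the p summands is 1 modulo the divisor. So a higher cyclotomic polynomial is the
  constant p modulo a lower one, the only arithmetic relation needed between different
  levels.\<close>

lemma dvd_shifted_cyclotomic_Suc_diff:
  "[:1, 1:] ^ p ^ k - 1 dvd shifted_cyclotomic p (Suc k) - (of_nat p :: 'a::field_char_0 poly)"
proof -
  have "[:1, 1:] ^ p ^ k - 1 dvd (\<Sum>m<p. ([:1, 1:] ^ p ^ k) ^ m - (1 :: 'a poly))"
    by (intro dvd_sum) (simp add: power_diff_1_eq)
  also have "\<dots> = shifted_cyclotomic p (Suc k) - of_nat p"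
    by (simp add: sum_subtractf power_mult[symmetric] mult.commute)
  finally show ?thesis .
qed

lemma shifted_cyclotomic_dvd_diff:
  assumes "i < j"
  shows "shifted_cyclotomic p i dvd shifted_cyclotomic p j - (of_nat p :: 'a::field_char_0 poly)"
proof -
  obtain k where "j = Suc k" "i \<le> k" using assms by (cases j) auto
  then show ?thesis
    using dvd_trans[OF shifted_cyclotomic_dvd dvd_shifted_cyclotomic_Suc_diff] by blast
qed

section \<open>The glued lattice\<close>

locale glued_lattice = adic_subring p K
  for p :: nat and K :: "'f::field_char_0 set" +
  fixes n s :: nat
  assumes n_pos: "n > 0" and s_ge: "s \<ge> 3"
begin

text \<open>The levels 0, 1, 2, s are numbered consecutively; index 3 is the faithful level
  s.\<close>

definition P :: "nat \<Rightarrow> 'f poly" where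
  "P l = shifted_cyclotomic p (if l = 3 then s else l)"

definition copies :: "nat \<Rightarrow> nat" where
  "copies l = (if l = 1 then Suc n else n)"

abbreviation X :: "'f poly" where "X \<equiv> [:0, 1:]"
abbreviation z :: "'f poly" where "z \<equiv> [:1, 1:]"

lemma lead_coeff_P: "lead_coeff (P l) = 1"
  by (simp add: P_def lead_coeff_shifted_cyclotomic)

lemma P_over: "P l \<in> polys_over"
proof -
  have "shifted_cyclotomic p i \<in> polys_over" for i
    by (cases i) (auto intro!: polys_over_sum polys_over_power
        simp: polys_over_pCons polys_over_0 zero_closed one_closed)
  then show ?thesis by (simp add: P_def)
qed

lemma coeff_0_P: "coeff (P l) 0 \<in> pK"
proof -
  have "coeff (shifted_cyclotomic p i :: 'f poly) 0 \<in> pK" for i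
    by (cases i) (simp_all add: coeff_0_shifted_cyclotomic pK_zero pK_p del: shifted_cyclotomic.simps(2))
  then show ?thesis by (simp add: P_def)
qed

lemma degree_P_pos: "degree (P l) > 0"
proof (rule ccontr)
  assume "\<not> degree (P l) > 0"
  then have "coeff (P l) 0 = 1" using lead_coeff_P[of l] by simp
  then show False using coeff_0_P[of l] one_notin_pK by simp
qed

lemma P_nonzero [simp]: "P l \<noteq> 0"
  using degree_P_pos[of l] by auto

lemma P_dvd_diff: "i < j \<Longrightarrow> j < 4 \<Longrightarrow> P i dvd P j - [:of_nat p:]"
  using s_ge shifted_cyclotomic_dvd_diff[where p = p and 'a = 'f]
  by (simp add: P_def of_nat_poly del: shifted_cyclotomic.simps)

lemma P_dvd_z_power: "l < 4 \<Longrightarrow> P l dvd z ^ p ^ s - 1"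
  using s_ge by (simp add: P_def shifted_cyclotomic_dvd del: shifted_cyclotomic.simps)

lemma P_dvd_z_power': "l < 3 \<Longrightarrow> P l dvd z ^ p ^ (s - 1) - 1"
  using s_ge by (simp add: P_def shifted_cyclotomic_dvd del: shifted_cyclotomic.simps)

text \<open>Modulo z^(p^(s-1)) - 1 the polynomial \<open>P 3\<close> is the constant p, so
  divisibility would make \<open>P 3\<close> divide a nonzero constant. This is why the element of
  order p acts nontrivially on level s.\<close>

lemma P3_not_dvd: "\<not> P 3 dvd z ^ p ^ (s - 1) - 1"
proof
  assume "P 3 dvd z ^ p ^ (s - 1) - 1"
  also have "z ^ p ^ (s - 1) - 1 dvd P 3 - [:of_nat p:]"
    using dvd_shifted_cyclotomic_Suc_diff[of p "s - 1", where 'a = 'f] s_ge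
    by (simp add: P_def of_nat_poly del: shifted_cyclotomic.simps)
  finally have "P 3 dvd P 3 - (P 3 - [:of_nat p:])" by (rule dvd_diff[OF dvd_refl])
  then have "P 3 dvd [:of_nat p:]" by simp
  then have "degree (P 3) \<le> degree [:of_nat p :: 'f:]" by (intro dvd_imp_degree_le) auto
  then show False using degree_P_pos[of 3] by simp
qed

text \<open>Chinese remaindering over \<open>F\<close>, where p is invertible; a product of pairwise
  projectors does it.\<close>

lemma ex_projector:
  assumes i: "i < 4"
  shows "\<exists>e. P i dvd e - 1 \<and> (\<forall>j<4. j \<noteq> i \<longrightarrow> P j dvd e)"
proof -
  \<comment> \<open>For i < j the polynomial \<open>P j\<close>/p is 1 modulo \<open>P i\<close>;
    for j < i take 1 - \<open>P i\<close>/p.\<close>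
  have pair: "\<exists>u. P i dvd u - 1 \<and> P j dvd u" if j: "j < 4" "j \<noteq> i" for j
  proof (cases "i < j")
    case True
    have "P j * [:1 / of_nat p:] - 1 = (P j - [:of_nat p:]) * [:1 / of_nat p:]"
      by (simp add: algebra_simps one_pCons)
    then show ?thesis
      using P_dvd_diff[OF True j(1)] by (intro exI[of _ "P j * [:1 / of_nat p:]"]) (simp del: mult_pCons_right)
  next
    case False
    then have ji: "j < i" using j by simp
    have "1 - P i * [:1 / of_nat p:] = - ((P i - [:of_nat p:]) * [:1 / of_nat p:])"
      by (simp add: algebra_simps one_pCons)
    then have "P j dvd 1 - P i * [:1 / of_nat p:]"
      using P_dvd_diff[OF ji i] by (simp del: mult_pCons_right)
    moreover have "P i dvd (1 - P i * [:1 / of_nat p:]) - 1"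
      by (simp del: mult_pCons_right)
    ultimately show ?thesis by blast
  qed
  have "\<exists>e. P i dvd e - 1 \<and> (\<forall>j\<in>S. P j dvd e)" if "finite S" "S \<subseteq> {..<4} - {i}" for S
    using that
  proof (induction S rule: finite_induct)
    case empty
    show ?case by (intro exI[of _ 1]) simp
  next
    case (insert j S)
    then obtain e where e: "P i dvd e - 1" "\<forall>j\<in>S. P j dvd e" by auto
    obtain u where u: "P i dvd u - 1" "P j dvd u" using pair insert.prems by auto
    have "e * u - 1 = (e - 1) * u + (u - 1)" by (simp add: algebra_simps)
    then have "P i dvd e * u - 1" using e u by (metis dvd_add dvd_mult2)
    then show ?case using e u by (intro exI[of _ "e * u"]) auto
  qed
  from this[of "{..<4} - {i}"] show ?thesis by auto
qed

text \<open>Elements of \<open>FM\<close> are families of polynomials in \<open>t = x - 1\<close>: \<open>w l j\<close> is the reduced representative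
  of the component in the \<open>j\<close>-th copy of level \<open>l\<close>, where \<open>l = 3\<close> stands for the cyclotomic level \<open>s\<close>.\<close>

definition W :: "(nat \<Rightarrow> nat \<Rightarrow> 'f poly) set" where
  "W = {w. \<forall>l j. degree (w l j) < degree (P l) \<and> (w l j = 0 \<or> l < 4 \<and> j < copies l)}"

text \<open>As t = x - 1 vanishes in the residue fields, the residue of a component is its constant
  coefficient modulo \<open>pK\<close>. So \<open>L\<close> is the sum of the free modules,
  \<open>L0\<close> its elements of residue zero, and \<open>M\<close> those with residues in
  V.\<close>

definition L :: "(nat \<Rightarrow> nat \<Rightarrow> 'f poly) set" where
  "L = {w \<in> W. \<forall>l j. w l j \<in> polys_over}"

definition L0 :: "(nat \<Rightarrow> nat \<Rightarrow> 'f poly) set" where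
  "L0 = {w \<in> L. \<forall>l j. coeff (w l j) 0 \<in> pK}"

definition M :: "(nat \<Rightarrow> nat \<Rightarrow> 'f poly) set" where
  "M = {w \<in> L. \<forall>j<n. coeff (w 2 j) 0 - coeff (w 0 j) 0 - coeff (w 1 j) 0 \<in> pK
                 \<and> coeff (w 3 j) 0 - coeff (w 0 j) 0 - coeff (w 1 (Suc j)) 0 \<in> pK}"

definition act :: "'f poly \<Rightarrow> (nat \<Rightarrow> nat \<Rightarrow> 'f poly) \<Rightarrow> nat \<Rightarrow> nat \<Rightarrow> 'f poly" where
  "act g w = (\<lambda>l j. (g * w l j) mod P l)"

section \<open>Polynomial action and stability of the lattices\<close>

lemma degree_mod_P: "degree (f mod P l) < degree (P l)"
  using degree_mod_less'[of "P l" f] degree_P_pos[of l] by (cases "f mod P l = 0") auto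

lemma W_I:
  assumes "\<And>l j. degree (w l j) < degree (P l)" "\<And>l j. \<not> (l < 4 \<and> j < copies l) \<Longrightarrow> w l j = 0"
  shows "w \<in> W"
  using assms unfolding W_def by blast

lemma W_degree: "w \<in> W \<Longrightarrow> degree (w l j) < degree (P l)"
  and W_zero: "w \<in> W \<Longrightarrow> \<not> (l < 4 \<and> j < copies l) \<Longrightarrow> w l j = 0"
  unfolding W_def by blast+

lemma act_W: "w \<in> W \<Longrightarrow> act g w \<in> W"
  by (rule W_I) (simp_all add: act_def degree_mod_P W_zero)

lemma mod_P_W: "w \<in> W \<Longrightarrow> w l j mod P l = w l j"
  by (simp add: W_degree mod_poly_less)

lemma W_add: "w \<in> W \<Longrightarrow> v \<in> W \<Longrightarrow> w + v \<in> W"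
  by (rule W_I) (simp_all add: W_zero W_degree degree_add_less)

lemma W_diff: "w \<in> W \<Longrightarrow> v \<in> W \<Longrightarrow> w - v \<in> W"
  by (rule W_I) (simp_all add: W_zero W_degree degree_diff_less)

lemma W_0: "0 \<in> W"
  by (simp add: W_def degree_P_pos)

lemma act_add: "act g (w + v) = act g w + act g v"
  by (simp add: act_def fun_eq_iff distrib_left poly_mod_add_left)

lemma act_diff: "act g (w - v) = act g w - act g v"
  by (simp add: act_def fun_eq_iff right_diff_distrib poly_mod_diff_left)

lemma act_add_left: "act (g + h) w = act g w + act h w"
  by (simp add: act_def fun_eq_iff distrib_right poly_mod_add_left)

lemma act_act: "act g (act h w) = act (g * h) w"
  by (simp add: act_def fun_eq_iff mod_mult_right_eq mult.assoc)

lemma act_const: "w \<in> W \<Longrightarrow> act [:c:] w = (\<lambda>l j. smult c (w l j))"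
  by (simp add: act_def fun_eq_iff mod_smult_left mod_P_W)

lemma act_1: "w \<in> W \<Longrightarrow> act 1 w = w"
  by (simp add: act_def fun_eq_iff mod_P_W)

lemma act_cong:
  assumes "w \<in> W" "\<And>l. l < 4 \<Longrightarrow> P l dvd g - h"
  shows "act g w = act h w"
proof (intro ext)
  fix l j
  show "act g w l j = act h w l j"
  proof (cases "l < 4")
    case True
    then have "P l dvd (g - h) * w l j" using assms by simp
    then show ?thesis by (simp add: act_def mod_eq_dvd_iff left_diff_distrib)
  next
    case False
    then show ?thesis using assms by (simp add: W_zero act_def)
  qed
qed

lemma L_W: "w \<in> L \<Longrightarrow> w \<in> W" and M_L: "w \<in> M \<Longrightarrow> w \<in> L" and L0_L: "w \<in> L0 \<Longrightarrow> w \<in> L"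
  by (simp_all add: L_def M_def L0_def)

lemma L0_M: "w \<in> L0 \<Longrightarrow> w \<in> M"
  by (simp add: L0_def M_def pK_diff)

lemma L_add: "w \<in> L \<Longrightarrow> v \<in> L \<Longrightarrow> w + v \<in> L"
  by (simp add: L_def W_add polys_over_add)

lemma L_diff: "w \<in> L \<Longrightarrow> v \<in> L \<Longrightarrow> w - v \<in> L"
  by (simp add: L_def W_diff polys_over_diff)

lemma L_act: "w \<in> L \<Longrightarrow> g \<in> polys_over \<Longrightarrow> act g w \<in> L"
  by (simp add: L_def act_W) (simp add: act_def polys_over_mod polys_over_mult P_over lead_coeff_P)

lemma L0_add: "w \<in> L0 \<Longrightarrow> v \<in> L0 \<Longrightarrow> w + v \<in> L0"
  by (simp add: L0_def L_add pK_add)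

lemma L0_diff: "w \<in> L0 \<Longrightarrow> v \<in> L0 \<Longrightarrow> w - v \<in> L0"
  by (simp add: L0_def L_diff pK_diff)

lemma M_add: "w \<in> M \<Longrightarrow> v \<in> M \<Longrightarrow> w + v \<in> M"
proof -
  assume wv: "w \<in> M" "v \<in> M"
  have eq: "(a + a') - (b + b') - (c + c') = (a - b - c) + (a' - b' - c')" for a b c a' b' c' :: 'f
    by simp
  show "w + v \<in> M"
    using wv unfolding M_def by (simp add: L_add eq pK_add)
qed

lemma const_over: "c \<in> K \<Longrightarrow> [:c:] \<in> polys_over"
  by (simp add: polys_over_pCons polys_over_0)

lemma X_over: "X \<in> polys_over" and z_over: "z \<in> polys_over"
  by (simp_all add: polys_over_pCons polys_over_0 zero_closed one_closed)

lemma L0_act_const: "w \<in> L0 \<Longrightarrow> c \<in> K \<Longrightarrow> act [:c:] w \<in> L0"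
  using L_act[OF L0_L const_over] by (simp add: L0_def act_const[OF L_W] pK_mult)

lemma L0_act_p: "w \<in> L \<Longrightarrow> act [:of_nat p:] w \<in> L0"
  using L_act[OF _ const_over[OF of_nat_closed]]
  by (simp add: L0_def act_const[OF L_W] pK_iff) (simp add: L_def polys_over_def)

text \<open>Reducing t f modulo \<open>P l\<close> takes one subtraction of a multiple of
  \<open>P l\<close>, whose constant coefficient lies in \<open>pK\<close>.\<close>

lemma L0_act_X:
  assumes "w \<in> L"
  shows "act X w \<in> L0"
proof -
  have "coeff (act X w l j) 0 \<in> pK" for l j
  proof -
    have w: "w l j mod P l = w l j" "w l j \<in> polys_over" using assms by (auto simp: L_def mod_P_W)
    have "act X w l j = pCons 0 (w l j) mod P l" by (simp add: act_def)
    also have "\<dots> = pCons 0 (w l j) - smult (coeff (pCons 0 (w l j)) (degree (P l))) (P l)"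
      unfolding mod_pCons[OF P_nonzero] w(1) by (simp add: lead_coeff_P)
    finally have "coeff (act X w l j) 0 = 0 - coeff (pCons 0 (w l j)) (degree (P l)) * coeff (P l) 0"
      by simp
    also have "\<dots> \<in> pK"
      by (intro pK_diff pK_zero pK_mult coeff_0_P)
        (use w(2) in \<open>auto simp: polys_over_def coeff_pCons zero_closed split: nat.splits\<close>)
    finally show ?thesis .
  qed
  then show ?thesis using L_act[OF assms X_over] by (simp add: L0_def)
qed

lemma M_act_const: "w \<in> M \<Longrightarrow> c \<in> K \<Longrightarrow> act [:c:] w \<in> M"
proof -
  assume w: "w \<in> M" and c: "c \<in> K"
  have eq: "c * a - c * b - c * d = c * (a - b - d)" for a b d
    by (simp add: algebra_simps)
  show "act [:c:] w \<in> M"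
    using w c L_act[OF M_L[OF w] const_over[OF c]]
    unfolding M_def by (simp add: act_const[OF L_W[OF M_L[OF w]]] eq pK_mult)
qed

text \<open>The generator is 1 + t, and t sends \<open>L\<close> into \<open>L0\<close>, which is
  contained in \<open>M\<close>.\<close>

lemma M_act_z: "w \<in> M \<Longrightarrow> act z w \<in> M"
proof -
  assume w: "w \<in> M"
  have "z = 1 + X" by (simp add: one_pCons)
  then have "act z w = w + act X w"
    using act_1[OF L_W[OF M_L[OF w]]] act_add_left[of 1 X w] by simp
  then show ?thesis using M_add[OF w L0_M[OF L0_act_X[OF M_L[OF w]]]] by simp
qed

text \<open>Split off the constant coefficient: it is divisible by p, the rest by t. Thus
  \<open>L0\<close> = t\<open>L\<close> + p\<open>L\<close>, a description that module endomorphisms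
  respect.\<close>

lemma L0_decompose:
  assumes "w \<in> L0"
  obtains u v where "u \<in> L" "v \<in> L" "w = act X u + act [:of_nat p:] v"
proof -
  define u where "u = (\<lambda>l j. poly_shift 1 (w l j))"
  define v where "v = (\<lambda>l j. [:coeff (w l j) 0 / of_nat p:])"
  have wW: "w \<in> W" using assms by (simp add: L0_def L_def)
  have wK: "coeff (w l j) k \<in> K" "coeff (w l j) 0 \<in> pK" for l j k
    using assms by (simp_all add: L0_def L_def polys_over_def)
  have split: "w l j = pCons (coeff (w l j) 0) (u l j)" for l j
    by (rule poly_eqI) (auto simp: u_def coeff_pCons coeff_poly_shift split: nat.splits)
  have deg: "degree (u l j) < degree (P l)" "degree (pCons 0 (u l j)) < degree (P l)" for l j
  proof -
    have "degree (w l j) < degree (P l)" using wW by (rule W_degree)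
    then have "u l j = 0 \<or> Suc (degree (u l j)) < degree (P l)"
      by (subst (asm) split) (auto simp: degree_pCons_eq_if split: if_splits)
    then show "degree (u l j) < degree (P l)" "degree (pCons 0 (u l j)) < degree (P l)"
      using degree_P_pos[of l] by auto
  qed
  have "u \<in> W" by (rule W_I) (use deg W_zero[OF wW] in \<open>simp_all add: u_def\<close>)
  then have "u \<in> L" by (simp add: L_def polys_over_def) (simp add: u_def coeff_poly_shift wK)
  moreover have "v \<in> W" by (rule W_I) (use W_zero[OF wW] in \<open>simp_all add: v_def degree_P_pos\<close>)
  then have vL: "v \<in> L" using wK by (simp add: L_def v_def const_over flip: pK_iff)
  moreover have "w = act X u + act [:of_nat p:] v"
  proof (intro ext)
    fix l j
    have "act X u l j = pCons 0 (u l j)" using deg by (simp add: act_def mod_poly_less)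
    then show "w l j = (act X u + act [:of_nat p:] v) l j"
      by (subst split) (simp add: act_const[OF L_W[OF vL]], simp add: v_def)
  qed
  ultimately show thesis by (rule that)
qed

text \<open>Since z^(p^s) acts as 1, the binomial congruence turns t^(p^s) into a multiple of
  p.\<close>

lemma X_power_L:
  assumes "u \<in> L"
  obtains v where "v \<in> L" "act (X ^ p ^ s) u = act [:of_nat p:] v"
proof -
  obtain g where g: "g \<in> polys_over" "z ^ (p ^ s) = 1 + X ^ (p ^ s) + smult (of_nat p) g"
    using power_one_plus_X_mod_p by blast
  have "X ^ p ^ s - [:of_nat p:] * (- g) = z ^ p ^ s - 1" using g(2) by simp
  then have "act (X ^ p ^ s) u = act ([:of_nat p:] * (- g)) u"
    using assms by (intro act_cong) (auto simp del: mult_pCons_left intro: P_dvd_z_power L_W)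
  also have "\<dots> = act [:of_nat p:] (act (- g) u)" by (simp only: act_act)
  finally have "act (X ^ p ^ s) u = act [:of_nat p:] (act (- g) u)" .
  moreover have "- g \<in> polys_over" using g(1) by (simp add: polys_over_def uminus_closed)
  ultimately show thesis using that L_act[OF assms] by blast
qed

section \<open>Projections onto the levels\<close>

definition part :: "nat \<Rightarrow> (nat \<Rightarrow> nat \<Rightarrow> 'f poly) \<Rightarrow> nat \<Rightarrow> nat \<Rightarrow> 'f poly" where
  "part l w = (\<lambda>l' j. if l' = l then w l' j else 0)"

lemma part_W: "w \<in> W \<Longrightarrow> part l w \<in> W"
  using W_zero[of w] by (intro W_I) (auto simp: part_def W_degree degree_P_pos)

lemma part_L: "w \<in> L \<Longrightarrow> part l w \<in> L"
  using part_W by (simp add: L_def) (simp add: part_def polys_over_0)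

text \<open>The projection is multiplication by a polynomial over \<open>F\<close>, so every
  F[t]-linear map commutes with it.\<close>

lemma part_eq_act:
  assumes "l < 4"
  obtains e where "\<And>w. w \<in> W \<Longrightarrow> part l w = act e w"
proof -
  obtain e where e: "P l dvd e - 1" "\<And>j. j < 4 \<Longrightarrow> j \<noteq> l \<Longrightarrow> P j dvd e"
    using ex_projector[OF assms] by blast
  have "part l w = act e w" if w: "w \<in> W" for w
  proof (intro ext)
    fix l' j
    consider "l' = l" | "l' \<noteq> l" "l' < 4" | "l' \<noteq> l" "\<not> l' < 4" by blast
    then show "part l w l' j = act e w l' j"
    proof cases
      case 1
      have "P l dvd (e - 1) * w l j" using e by simp
      then have "(e * w l j) mod P l = w l j mod P l"
        by (simp add: mod_eq_dvd_iff left_diff_distrib)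
      then show ?thesis using 1 w by (simp add: part_def act_def mod_P_W)
    next
      case 2
      then show ?thesis using e by (simp add: part_def act_def mod_eq_0_iff_dvd)
    next
      case 3
      then have "w l' j = 0" using w by (simp add: W_zero)
      then show ?thesis using 3 by (simp add: part_def act_def)
    qed
  qed
  then show thesis by (rule that)
qed

end

section \<open>Endomorphisms\<close>

context glued_lattice begin

text \<open>Endomorphisms of the lattice \<open>M\<close>, extended to \<open>FM\<close>: linearity
  over F[t] combines F-linearity with compatibility with the generator.\<close>

definition endo :: "((nat \<Rightarrow> nat \<Rightarrow> 'f poly) \<Rightarrow> nat \<Rightarrow> nat \<Rightarrow> 'f poly) \<Rightarrow> bool" where
  "endo E \<longleftrightarrow> (\<forall>w\<in>W. E w \<in> W) \<and> (\<forall>w\<in>W. \<forall>v\<in>W. E (w + v) = E w + E v)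
     \<and> (\<forall>w\<in>W. \<forall>g. E (act g w) = act g (E w)) \<and> (\<forall>w\<in>M. E w \<in> M)"

lemma endo_W: "endo E \<Longrightarrow> w \<in> W \<Longrightarrow> E w \<in> W"
  and endo_add: "endo E \<Longrightarrow> w \<in> W \<Longrightarrow> v \<in> W \<Longrightarrow> E (w + v) = E w + E v"
  and endo_act: "endo E \<Longrightarrow> w \<in> W \<Longrightarrow> E (act g w) = act g (E w)"
  and endo_M: "endo E \<Longrightarrow> w \<in> M \<Longrightarrow> E w \<in> M"
  by (simp_all add: endo_def)

lemma endo_0: "endo E \<Longrightarrow> E 0 = 0"
  using endo_add[of E 0 0] W_0 by simp

lemma endo_part: "endo E \<Longrightarrow> w \<in> W \<Longrightarrow> l < 4 \<Longrightarrow> E (part l w) = part l (E w)"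
  using part_eq_act[of l] endo_act endo_W by metis

text \<open>Constant lifts of the vectors (a, b, a + b', a + b'') of V. They satisfy the glueing
  conditions exactly, not only modulo p.\<close>

definition glue :: "(nat \<Rightarrow> 'f) \<Rightarrow> (nat \<Rightarrow> 'f) \<Rightarrow> nat \<Rightarrow> nat \<Rightarrow> 'f poly" where
  "glue a b = (\<lambda>l j. if l < 4 \<and> j < copies l then
     [:if l = 0 then a j else if l = 1 then b j else if l = 2 then a j + b j else a j + b (Suc j):]
     else 0)"

lemma glue_M:
  assumes "\<And>j. a j \<in> K" "\<And>j. b j \<in> K"
  shows "glue a b \<in> M"
proof -
  have "glue a b \<in> W" by (rule W_I) (auto simp: glue_def degree_P_pos)
  moreover have "glue a b l j \<in> polys_over" for l j
    using assms by (simp add: glue_def const_over polys_over_0 add_closed)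
  ultimately have "glue a b \<in> L" by (simp add: L_def)
  moreover have "coeff (glue a b 2 j) 0 - coeff (glue a b 0 j) 0 - coeff (glue a b 1 j) 0 = 0"
    "coeff (glue a b 3 j) 0 - coeff (glue a b 0 j) 0 - coeff (glue a b 1 (Suc j)) 0 = 0" if "j < n" for j
    using that by (simp_all add: glue_def copies_def)
  ultimately show ?thesis by (simp add: M_def pK_zero)
qed

lemma part_M_surj:
  assumes w: "w \<in> L" and l: "l < 4"
  obtains v where "v \<in> M" "part l v = part l w"
proof -
  \<comment> \<open>The residues of \<open>w\<close> on level \<open>l\<close> are prescribed
    through b if \<open>l\<close> = 1 and through a otherwise; the other parameter is 0. What
    remains on level \<open>l\<close> has constant coefficient 0 and so lies in
    \<open>L0\<close>.\<close>
  define a where "a j = (if l = 1 then 0 else coeff (w l j) 0)" for j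
  define b where "b j = (if l = 1 then coeff (w l j) 0 else 0)" for j
  have K: "coeff (w i j) k \<in> K" for i j k using w by (simp add: L_def polys_over_def)
  have g: "glue a b \<in> M" by (rule glue_M) (simp_all add: a_def b_def K zero_closed)
  define d where "d = part l w - part l (glue a b)"
  have "d \<in> L" unfolding d_def by (rule L_diff[OF part_L[OF w] part_L[OF M_L[OF g]]])
  moreover have "coeff (d i j) 0 = 0" for i j
    using l W_zero[OF L_W[OF w], of i j]
    by (auto simp: d_def part_def glue_def a_def b_def)
  ultimately have "d \<in> L0" by (simp add: L0_def pK_zero)
  then have "glue a b + d \<in> M" using M_add g L0_M by blast
  moreover have "part l (glue a b + d) = part l w"
    by (simp add: d_def part_def fun_eq_iff)
  ultimately show thesis by (rule that)
qed

text \<open>Every level projects \<open>M\<close> onto the corresponding part of \<open>L\<close>, and endomorphisms preserve levels.\<close>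

lemma endo_L:
  assumes E: "endo E" and w: "w \<in> L"
  shows "E w \<in> L"
proof -
  have "E w l j \<in> polys_over" for l j
  proof (cases "l < 4")
    case True
    obtain v where v: "v \<in> M" "part l v = part l w" using part_M_surj[OF w True] .
    have "part l (E w) = part l (E v)"
      using endo_part[OF E _ True] v(2) L_W[OF w] L_W[OF M_L[OF v(1)]] by metis
    then have "E w l j = E v l j" by (metis part_def)
    then show ?thesis using M_L[OF endo_M[OF E v(1)]] by (simp add: L_def)
  next
    case False
    then show ?thesis using W_zero[OF endo_W[OF E L_W[OF w]]] by (simp add: polys_over_0)
  qed
  then show ?thesis using endo_W[OF E L_W[OF w]] by (simp add: L_def)
qed

text \<open>An endomorphism commutes with t and p and preserves \<open>L\<close>, hence preserves
  t\<open>L\<close> + p\<open>L\<close>.\<close>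

lemma endo_L0:
  assumes E: "endo E" and w: "w \<in> L0"
  shows "E w \<in> L0"
proof -
  obtain u v where uv: "u \<in> L" "v \<in> L" "w = act X u + act [:of_nat p:] v"
    using L0_decompose[OF w] .
  have "E w = act X (E u) + act [:of_nat p:] (E v)"
    using uv by (simp only: endo_add[OF E] endo_act[OF E] act_W L_W)
  then show ?thesis using L0_add L0_act_X L0_act_p endo_L[OF E] uv by simp
qed

section \<open>Residue matrices of an endomorphism\<close>

definition unit :: "nat \<Rightarrow> nat \<Rightarrow> nat \<Rightarrow> nat \<Rightarrow> 'f poly" where
  "unit l j = (\<lambda>l' j'. if l' = l \<and> j' = j then 1 else 0)"

lemma unit_L: "l < 4 \<Longrightarrow> j < copies l \<Longrightarrow> unit l j \<in> L"
proof -
  assume "l < 4" "j < copies l"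
  then have "unit l j \<in> W" by (intro W_I) (auto simp: unit_def degree_P_pos)
  then show ?thesis
    by (simp add: L_def) (simp add: unit_def polys_over_0 one_pCons const_over one_closed)
qed

lemma act_const_unit:
  assumes "l < 4" "j < copies l"
  shows "act [:c:] (unit l j) = (\<lambda>l' j'. if l' = l \<and> j' = j then [:c:] else 0)"
  unfolding act_const[OF L_W[OF unit_L[OF assms]]]
  by (auto simp: unit_def fun_eq_iff one_pCons)

lemma part_unit: "part l (unit l j) = unit l j"
  by (auto simp: part_def unit_def fun_eq_iff)

definition entry where "entry E l i j = coeff (E (unit l j) l i) 0"

text \<open>The level \<open>l\<close> component of the image depends only on that of
  \<open>w\<close>. For a glued basis vector the latter is a unit vector or 0, so a column of the
  residue matrix or 0 is read off.\<close>

lemma endo_entry_glue: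
  assumes E: "endo E" and w: "w \<in> W" and l: "l < 4"
    and pw: "part l w = (if Q then unit l j else 0)"
  shows "coeff (E w l i) 0 = (if Q then entry E l i j else 0)"
proof -
  have "E w l i = part l (E w) l i" by (simp add: part_def)
  also have "\<dots> = E (part l w) l i" using endo_part[OF E w l] by simp
  finally show ?thesis using pw endo_0[OF E] by (simp add: entry_def)
qed

text \<open>The images of the glued basis vectors show that the matrix on level 1 is constant along its diagonals
  and vanishes in its last column above, and in its first column below the diagonal.\<close>

lemma endo_scalar_mod_p:
  assumes E: "endo E"
  shows "\<exists>c\<in>K. \<forall>l<4. \<forall>i<copies l. \<forall>j<copies l. entry E l i j - (if i = j then c else 0) \<in> pK"
proof -
  define a where "a = entry E"
  have M_rel: "coeff (w 2 i) 0 - coeff (w 0 i) 0 - coeff (w 1 i) 0 \<in> pK"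
     "coeff (w 3 i) 0 - coeff (w 0 i) 0 - coeff (w 1 (Suc i)) 0 \<in> pK" if "w \<in> M" "i < n" for w i
    using that by (simp_all add: M_def)
  \<comment> \<open>The basis vectors of a appear on levels 0, 2, 3 alike, so these three matrices
    agree modulo p.\<close>
  have a20: "a 2 i j - a 0 i j \<in> pK" and a30: "a 3 i j - a 0 i j \<in> pK" if "i < n" "j < n" for i j
  proof -
    define w where "w = glue (\<lambda>k. if k = j then 1 else 0) (\<lambda>_. 0)"
    have wM: "w \<in> M" unfolding w_def by (rule glue_M) (auto simp: zero_closed one_closed)
    have part_w: "part l w = (if l \<noteq> 1 then unit l j else 0)" if "l < 4" for l
      using that \<open>j < n\<close>
      by (auto simp: w_def part_def glue_def unit_def copies_def fun_eq_iff one_pCons)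
    have val: "coeff (E w l i') 0 = (if l \<noteq> 1 then a l i' j else 0)" if "l < 4" for l i'
      unfolding a_def by (rule endo_entry_glue[OF E L_W[OF M_L[OF wM]] that part_w[OF that]])
    show "a 2 i j - a 0 i j \<in> pK" "a 3 i j - a 0 i j \<in> pK"
      using M_rel[OF endo_M[OF E wM] \<open>i < n\<close>] by (simp_all add: val)
  qed
  \<comment> \<open>The basis vector j of b appears on level 2 unless j = n, and on level 3 at
    position j - 1 unless j = 0: b' drops the last entry, b'' the first.\<close>
  have b2: "(if j < n then a 2 i j else 0) - a 1 i j \<in> pK"
    and b3: "(if 0 < j then a 3 i (j - 1) else 0) - a 1 (Suc i) j \<in> pK" if "i < n" "j \<le> n" for i j
  proof -
    define w where "w = glue (\<lambda>_. 0) (\<lambda>k. if k = j then 1 else 0)"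
    have wM: "w \<in> M" unfolding w_def by (rule glue_M) (auto simp: zero_closed one_closed)
    note wW = L_W[OF M_L[OF wM]]
    have "part 0 w = (if False then unit 0 j else 0)"
      by (auto simp: w_def part_def glue_def fun_eq_iff)
    then have v0: "coeff (E w 0 i) 0 = 0" for i using endo_entry_glue[OF E wW] by fastforce
    have "part 1 w = (if True then unit 1 j else 0)"
      using \<open>j \<le> n\<close> by (auto simp: w_def part_def glue_def unit_def copies_def fun_eq_iff one_pCons)
    from endo_entry_glue[OF E wW _ this] have v1: "coeff (E w 1 i) 0 = a 1 i j" for i
      by (simp add: a_def)
    have "part 2 w = (if j < n then unit 2 j else 0)"
      by (auto simp: w_def part_def glue_def unit_def copies_def fun_eq_iff one_pCons)
    from endo_entry_glue[OF E wW _ this]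
    have v2: "coeff (E w 2 i) 0 = (if j < n then a 2 i j else 0)" for i by (simp add: a_def)
    have "part 3 w = (if 0 < j then unit 3 (j - 1) else 0)"
      using \<open>j \<le> n\<close> by (auto simp: w_def part_def glue_def unit_def copies_def fun_eq_iff one_pCons)
    from endo_entry_glue[OF E wW _ this]
    have v3: "coeff (E w 3 i) 0 = (if 0 < j then a 3 i (j - 1) else 0)" for i by (simp add: a_def)
    show "(if j < n then a 2 i j else 0) - a 1 i j \<in> pK"
      "(if 0 < j then a 3 i (j - 1) else 0) - a 1 (Suc i) j \<in> pK"
      using M_rel[OF endo_M[OF E wM] \<open>i < n\<close>] by (simp_all add: v0 v1[simplified] v2 v3)
  qed
  have tr: "x - w \<in> pK" if "x - y \<in> pK" "y - w \<in> pK" for x y w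
    using pK_add[OF that] by simp
  have sy: "y - x \<in> pK" if "x - y \<in> pK" for x y
    using pK_diff[OF pK_zero that] by simp
  have a10: "a 1 i j - a 0 i j \<in> pK" if "i < n" "j < n" for i j
    using tr[OF sy[OF b2[of i j]] ] a20[OF that] that by simp
  have step: "a 1 (Suc i) (Suc j) - a 1 i j \<in> pK" if "i < n" "j < n" for i j
  proof -
    have "a 3 i j - a 1 (Suc i) (Suc j) \<in> pK" using b3[of i "Suc j"] that by simp
    from tr[OF sy[OF this] a30[OF that]] show ?thesis using tr sy[OF a10[OF that]] by blast
  qed
  have up: "a 1 (i + k) (j + k) - a 1 i j \<in> pK" if "i + k \<le> n" "j + k \<le> n" for i j k
    using that
  proof (induction k)
    case (Suc k)
    then show ?case using tr[OF step[of "i + k" "j + k"]] by simp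
  qed (simp add: pK_zero)
  define c where "c = a 1 0 0"
  have "c \<in> K"
    using endo_L[OF E unit_L[of 1 0]] n_pos by (simp add: c_def a_def entry_def L_def polys_over_def copies_def)
  \<comment> \<open>An off-diagonal entry is moved along its diagonal to column n if i < j, to
    column 0 if j < i; there \<open>b2\<close> or \<open>b3\<close> makes it vanish modulo
    p.\<close>
  have a1: "a 1 i j - (if i = j then c else 0) \<in> pK" if "i \<le> n" "j \<le> n" for i j
  proof -
    consider "i = j" | "i < j" | "j < i" by linarith
    then show ?thesis
    proof cases
      case 1
      then show ?thesis using up[of 0 i 0] that by (simp add: c_def)
    next
      case 2
      have "0 - a 1 (i + (n - j)) n \<in> pK" using b2[of "i + (n - j)" n] that 2 by simp
      moreover have "a 1 (i + (n - j)) n - a 1 i j \<in> pK" using up[of i "n - j" j] that 2 by simp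
      ultimately have "a 1 i j - 0 \<in> pK" by (rule tr[OF sy sy, rotated])
      then show ?thesis using 2 by simp
    next
      case 3
      then have "0 - a 1 (i - j) 0 \<in> pK" using b3[of "i - j - 1" 0] that
        by (simp add: Suc_diff_Suc)
      moreover have "a 1 i j - a 1 (i - j) 0 \<in> pK" using up[of "i - j" j 0] that 3 by simp
      ultimately have "a 1 i j - 0 \<in> pK" by (rule tr[OF _ sy, rotated])
      then show ?thesis using 3 by simp
    qed
  qed
  have "entry E l i j - (if i = j then c else 0) \<in> pK"
    if "l < 4" "i < copies l" "j < copies l" for l i j
  proof -
    consider "l = 0" | "l = 1" | "l = 2" | "l = 3" using \<open>l < 4\<close> by linarith
    then show ?thesis
    proof cases
      case 2
      then show ?thesis using a1[of i j] that by (simp add: copies_def a_def)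
    next
      case 1
      then have ij: "i < n" "j < n" using that by (simp_all add: copies_def)
      then show ?thesis using tr[OF sy[OF a10[OF ij]] a1[of i j]] 1 by (simp add: a_def)
    next
      case 3
      then have ij: "i < n" "j < n" using that by (simp_all add: copies_def)
      then show ?thesis using tr[OF a20[OF ij] tr[OF sy[OF a10[OF ij]] a1[of i j]]] 3 by (simp add: a_def)
    next
      case 4
      then have ij: "i < n" "j < n" using that by (simp_all add: copies_def)
      then show ?thesis using tr[OF a30[OF ij] tr[OF sy[OF a10[OF ij]] a1[of i j]]] 4 by (simp add: a_def)
    qed
  qed
  with \<open>c \<in> K\<close> show ?thesis by blast
qed

text \<open>The difference of the endomorphism and the scalar maps unit vectors into
  \<open>L0\<close> and preserves \<open>L0\<close>. Modulo \<open>L0\<close> the unit vectors span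
  \<open>L\<close> over \<open>K\<close>.\<close>

lemma endo_scalar_mod_L0:
  assumes E: "endo E"
  shows "\<exists>c\<in>K. \<forall>w\<in>L. E w - act [:c:] w \<in> L0"
proof -
  obtain c where c: "c \<in> K"
    "\<And>l i j. l < 4 \<Longrightarrow> i < copies l \<Longrightarrow> j < copies l \<Longrightarrow> entry E l i j - (if i = j then c else 0) \<in> pK"
    using endo_scalar_mod_p[OF E] by blast
  define D where "D w = E w - act [:c:] w" for w
  have D_add: "D (w + v) = D w + D v" if "w \<in> W" "v \<in> W" for w v
    using that by (simp add: D_def endo_add[OF E] act_add)
  have D_act: "D (act g w) = act g (D w)" if "w \<in> W" for g w
    using that by (simp add: D_def endo_act[OF E] act_diff act_act mult.commute)
  have D_L: "D w \<in> L" if "w \<in> L" for w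
    unfolding D_def using that c(1) by (intro L_diff endo_L[OF E] L_act const_over)
  have D_L0: "D w \<in> L0" if "w \<in> L0" for w
    unfolding D_def using that c(1) by (intro L0_diff endo_L0[OF E] L0_act_const)
  have D_unit: "D (unit l j) \<in> L0" if lj: "l < 4" "j < copies l" for l j
  proof -
    have U: "unit l j \<in> L" using unit_L lj by blast
    have "coeff (D (unit l j) l' i) 0 \<in> pK" for l' i
    proof (cases "l' = l \<and> i < copies l")
      case True
      then show ?thesis using c(2)[OF lj(1) _ lj(2), of i]
        by (auto simp: D_def act_const_unit[OF lj] entry_def)
    next
      case False
      have "part l (E (unit l j)) = E (unit l j)"
        using endo_part[OF E L_W[OF U] lj(1)] by (simp add: part_unit)
      then have "l' \<noteq> l \<Longrightarrow> E (unit l j) l' i = 0" by (metis part_def)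
      then have "l' \<noteq> l \<Longrightarrow> D (unit l j) l' i = 0" by (simp add: D_def act_const_unit[OF lj])
      moreover have "l' = l \<Longrightarrow> D (unit l j) l' i = 0"
        using False W_zero[OF L_W[OF D_L[OF U]]] by simp
      ultimately show ?thesis by (cases "l' = l") (simp_all add: pK_zero)
    qed
    then show ?thesis using D_L[OF U] by (simp add: L0_def)
  qed
  have "D w \<in> L0" if w: "w \<in> L" for w
  proof -
    \<comment> \<open>\<open>res S\<close> keeps the constant coefficients of \<open>w\<close> at
      the positions in \<open>S\<close>. Positions are added one at a time, and the full set leaves
      a remainder in \<open>L0\<close>.\<close>
    define res where "res S = (\<lambda>l j. if (l, j) \<in> S then [:coeff (w l j) 0:] else 0)" for S
    define I where "I = (SIGMA l:{..<4}. {..<copies l})"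
    have K: "coeff (w l j) k \<in> K" for l j k using w by (simp add: L_def polys_over_def)
    have res_L: "res S \<in> L" if "S \<subseteq> I" for S
    proof -
      have "res S \<in> W"
        using that by (intro W_I) (auto simp: res_def I_def degree_P_pos)
      then show ?thesis by (simp add: L_def) (simp add: res_def polys_over_0 K const_over)
    qed
    have "D (res S) \<in> L0" if "finite S" "S \<subseteq> I" for S
      using that
    proof (induction S rule: finite_induct)
      case empty
      have "res {} = 0" by (simp add: res_def fun_eq_iff)
      moreover have "0 \<in> L0" by (simp add: L0_def L_def W_0 polys_over_0 pK_zero)
      ultimately show ?case by (metis D_L0)
    next
      case (insert x S)
      obtain l j where x: "x = (l, j)" by force
      then have lj: "l < 4" "j < copies l" using insert.prems by (auto simp: I_def)
      note U = L_W[OF unit_L[OF lj]]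
      have "res (insert x S) = res S + act [:coeff (w l j) 0:] (unit l j)"
        using insert.hyps x by (auto simp: res_def act_const_unit[OF lj] fun_eq_iff)
      then have "D (res (insert x S)) = D (res S) + act [:coeff (w l j) 0:] (D (unit l j))"
        using insert.prems res_L[THEN L_W] U by (simp add: D_add D_act act_W)
      moreover have "D (res S) \<in> L0" using insert by simp
      ultimately show ?case using L0_add[OF _ L0_act_const[OF D_unit[OF lj] K]] by metis
    qed
    then have 1: "D (res I) \<in> L0" by (simp add: I_def)
    have res_I: "coeff (res I l j) 0 = coeff (w l j) 0" for l j
      using W_zero[OF L_W[OF w], of l j] by (auto simp: res_def I_def)
    have "w - res I \<in> L0"
      using L_diff[OF w res_L[of I]] by (simp add: L0_def res_I pK_zero)
    then have 2: "D (w - res I) \<in> L0" by (rule D_L0)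
    have "w = res I + (w - res I)" by simp
    then have "D w = D (res I) + D (w - res I)"
      using D_add[OF L_W[OF res_L] L_W[OF L_diff[OF w res_L]], of I I] by simp
    then show ?thesis using L0_add 1 2 by simp
  qed
  then show ?thesis using c(1) by (auto simp: D_def)
qed

text \<open>Iterating E = E E puts the image of \<open>L\<close> into t^k \<open>L\<close> +
  p\<open>L\<close> for all k, hence into p\<open>L\<close>, as t is nilpotent modulo p. A second
  iteration puts it into p^k \<open>L\<close> for all k, and \<open>separated\<close>
  finishes.\<close>

lemma endo_idempotent_small:
  assumes E: "endo E" and idem: "\<And>w. w \<in> W \<Longrightarrow> E (E w) = E w"
    and small: "\<And>w. w \<in> L \<Longrightarrow> E w \<in> L0" and w: "w \<in> L"
  shows "E w = 0"
proof -
  let ?p = "[:of_nat p :: 'f:]"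
  have p_over: "?p \<in> polys_over" by (intro const_over of_nat_closed)
  have approx: "\<exists>u\<in>L. \<exists>v\<in>L. E w = act (X ^ k) u + act ?p v" if w: "w \<in> L" for w k
  proof (induction k)
    case 0
    have "E w = act (X ^ 0) (E w) + act ?p 0"
      using endo_W[OF E L_W[OF w]] act_1 by (simp add: act_def fun_eq_iff mod_P_W)
    moreover have "0 \<in> L" by (simp add: L_def W_0 polys_over_0)
    ultimately show ?case using endo_L[OF E w] by blast
  next
    case (Suc k)
    then obtain u v where uv: "u \<in> L" "v \<in> L" "E w = act (X ^ k) u + act ?p v" by blast
    obtain u' v' where uv': "u' \<in> L" "v' \<in> L" "E u = act X u' + act ?p v'"
      using L0_decompose[OF small[OF uv(1)]] .
    have "E w = E (E w)" using idem w L_W by simp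
    also have "\<dots> = act (X ^ k) (E u) + act ?p (E v)"
      using uv by (simp only: endo_add[OF E] endo_act[OF E] act_W L_W)
    also have "\<dots> = act (X ^ Suc k) u' + act ?p (act (X ^ k) v' + E v)"
      by (simp only: uv'(3) act_add act_act power_Suc2 mult.commute[of "X ^ k" ?p] add.assoc)
    finally show ?case
      using uv'(1) L_add[OF L_act[OF uv'(2) polys_over_power[OF X_over]] endo_L[OF E uv(2)]] by blast
  qed
  have p_div: "\<exists>v\<in>L. E w = act ?p v" if w: "w \<in> L" for w
  proof -
    obtain u v where uv: "u \<in> L" "v \<in> L" "E w = act (X ^ p ^ s) u + act ?p v"
      using approx[OF w] by blast
    obtain u' where "u' \<in> L" "act (X ^ p ^ s) u = act ?p u'" using X_power_L[OF uv(1)] .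
    then have "E w = act ?p (u' + v)" "u' + v \<in> L" using uv by (simp_all add: act_add L_add)
    then show ?thesis by blast
  qed
  have "\<exists>v\<in>L. E w = act (?p ^ k) v" for k
  proof (induction k)
    case 0
    then show ?case using endo_L[OF E w] act_1[OF endo_W[OF E L_W[OF w]]] by (metis power_0)
  next
    case (Suc k)
    then obtain v where v: "v \<in> L" "E w = act (?p ^ k) v" by blast
    obtain u where u: "u \<in> L" "E v = act ?p u" using p_div v(1) by blast
    have "E w = E (E w)" using idem w L_W by simp
    also have "\<dots> = act (?p ^ k) (E v)" using v endo_act[OF E L_W[OF v(1)]] by simp
    also have "\<dots> = act (?p ^ Suc k) u" using u by (simp only: act_act power_Suc2)
    finally show ?case using u by blast
  qed
  moreover have "?p ^ k = [:of_nat p ^ k:]" for k by (simp add: poly_const_pow)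
  ultimately have pk: "\<exists>v\<in>L. E w = act [:of_nat p ^ k:] v" for k by metis
  have "coeff (E w l j) i = 0" for l j i
  proof (rule separated)
    fix k
    obtain v where v: "v \<in> L" "E w = act [:of_nat p ^ k:] v" using pk by blast
    then have "coeff (E w l j) i = of_nat p ^ k * coeff (v l j) i" by (simp add: act_const L_W)
    then show "\<exists>b\<in>K. coeff (E w l j) i = of_nat p ^ k * b"
      using v(1) by (auto simp: L_def polys_over_def)
  qed
  then show ?thesis by (intro ext poly_eqI) simp
qed

text \<open>The scalar c is idempotent modulo p. If it is 0 there, E maps \<open>L\<close> into
  \<open>L0\<close>; if it is 1, then 1 - E does.\<close>

lemma endo_idempotent_trivial:
  assumes E: "endo E" and idem: "\<And>w. w \<in> W \<Longrightarrow> E (E w) = E w"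
  shows "(\<forall>w\<in>L. E w = 0) \<or> (\<forall>w\<in>L. E w = w)"
proof -
  obtain c where c: "c \<in> K" "\<And>w. w \<in> L \<Longrightarrow> E w - act [:c:] w \<in> L0"
    using endo_scalar_mod_L0[OF E] by blast
  have U: "unit 0 0 \<in> L" using n_pos by (intro unit_L) (simp_all add: copies_def)
  define u where "u = unit 0 0"
  have uL: "u \<in> L" using U by (simp add: u_def)
  \<comment> \<open>By E E = E this combination collapses to (c - c^2) u.\<close>
  have "E (E u) - act [:c:] (E u) + act [:c:] (E u - act [:c:] u) - (E u - act [:c:] u) \<in> L0"
    using L0_diff[OF L0_add[OF c(2)[OF endo_L[OF E uL]] L0_act_const[OF c(2)[OF uL] c(1)]] c(2)[OF uL]] .
  then have "act [:c:] u - act [:c:] (act [:c:] u) \<in> L0"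
    using idem[OF L_W[OF uL]] by (simp add: act_diff)
  then have "coeff ((act [:c:] u - act [:c * c:] u) 0 0) 0 \<in> pK"
    by (simp add: L0_def act_act mult.commute)
  then have "c - c * c \<in> pK"
    by (simp add: act_const[OF L_W[OF uL]]) (simp add: u_def unit_def)
  then have "0 - (c - c * c) \<in> pK" by (rule pK_diff[OF pK_zero])
  then have "c \<in> pK \<or> 1 - c \<in> pK" using idempotent_mod_p[OF c(1)] by simp
  then show ?thesis
  proof
    assume "c \<in> pK"
    then have "act [:c:] w \<in> L0" if "w \<in> L" for w
      using L_act[OF that const_over[OF c(1)]] that pK_mult[of "coeff (w _ _) 0" c]
      by (simp add: L0_def act_const[OF L_W]) (simp add: L_def polys_over_def mult.commute)
    then have "E w \<in> L0" if "w \<in> L" for w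
      using L0_add[OF c(2)[OF that], of "act [:c:] w"] that by simp
    then show ?thesis using endo_idempotent_small[OF E idem] by blast
  next
    assume c1: "1 - c \<in> pK"
    \<comment> \<open>The complementary idempotent, to be shown zero.\<close>
    define D where "D w = w - E w" for w
    have "M_diff": "w - v \<in> M" if "w \<in> M" "v \<in> M" for w v
    proof -
      have "w - v = w + act [:- 1:] v"
        using act_const[OF L_W[OF M_L[OF that(2)]]] by (simp add: fun_eq_iff)
      then show ?thesis
        using M_add[OF that(1) M_act_const[OF that(2) uminus_closed[OF one_closed]]] by metis
    qed
    have D: "endo D"
      unfolding endo_def D_def using endo_W[OF E] endo_add[OF E] endo_act[OF E] endo_M[OF E] M_diff
      by (auto simp: W_diff act_diff)
    have D_idem: "D (D w) = D w" if "w \<in> W" for w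
    proof -
      have "E w = E (D w + E w)" by (simp add: D_def)
      also have "\<dots> = E (D w) + E (E w)"
        using endo_add[OF E endo_W[OF D that] endo_W[OF E that]] .
      finally have "E (D w) = 0" using idem[OF that] by simp
      then show ?thesis by (simp add: D_def[of "D w"])
    qed
    have "D w \<in> L0" if w: "w \<in> L" for w
    proof -
      have "coeff (act [:1 - c:] w l j) 0 \<in> pK" for l j
        using w c1 pK_mult[of "coeff (w l j) 0" "1 - c"]
        by (simp add: act_const[OF L_W[OF w]] mult.commute L_def polys_over_def)
      then have "act [:1 - c:] w \<in> L0"
        using L_act[OF w const_over] c(1) one_closed diff_closed by (simp add: L0_def)
      moreover have "act [:1 - c:] w + act [:c:] w = w"
        using act_1[OF L_W[OF w]] by (simp add: act_add_left[symmetric] one_pCons)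
      then have "D w = act [:1 - c:] w - (E w - act [:c:] w)"
        unfolding D_def by (metis add_diff_eq diff_diff_eq2 diff_add_eq)
      ultimately show ?thesis using L0_diff c(2)[OF w] by simp
    qed
    then have "\<forall>w\<in>L. D w = 0" using endo_idempotent_small[OF D D_idem] by blast
    then show ?thesis by (simp add: D_def)
  qed
qed

end

section \<open>Lattices in coordinates\<close>

text \<open>A vector is built up coordinate by coordinate. \<open>K\<close> = \<open>UNIV\<close>
  gives the same induction for all vectors over \<open>F\<close>.\<close>

lemma lat_induct [consumes 2, case_names zero step]:
  assumes "0 \<in> K" and v: "v \<in> lat K m"
    and zero: "Q (0\<^sub>v m)"
    and step: "\<And>v c j. v \<in> lat K m \<Longrightarrow> c \<in> K \<Longrightarrow> j < m \<Longrightarrow> Q v \<Longrightarrow> Q (v + c \<cdot>\<^sub>v unit_vec m j)"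
  shows "Q v"
proof -
  define trunc where "trunc k = vec m (\<lambda>i. if i < k then v $ i else 0)" for k
  have trunc_lat: "trunc k \<in> lat K m" for k
    using assms(1) v by (auto simp: trunc_def lat_def)
  have "Q (trunc k)" if "k \<le> m" for k
    using that
  proof (induction k)
    case 0
    have "trunc 0 = 0\<^sub>v m" by (auto simp: trunc_def)
    then show ?case using zero by simp
  next
    case (Suc k)
    have "trunc (Suc k) = trunc k + (v $ k) \<cdot>\<^sub>v unit_vec m k"
      using Suc.prems by (auto simp: trunc_def less_Suc_eq intro!: eq_vecI)
    moreover have "v $ k \<in> K" using v Suc.prems by (simp add: lat_def)
    ultimately show ?case using step[OF trunc_lat] Suc by simp
  qed
  moreover have "trunc m = v" using v by (auto simp: trunc_def lat_def intro!: eq_vecI)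
  ultimately show ?thesis by (metis order_refl)
qed

lemma lat_UNIV: "lat UNIV m = carrier_vec m"
  by (auto simp: lat_def)

lemma unit_vec_lat: "0 \<in> K \<Longrightarrow> 1 \<in> K \<Longrightarrow> unit_vec m j \<in> lat K m"
  by (auto simp: lat_def unit_vec_def)

lemma mat_unit_vec_col:
  assumes "A \<in> carrier_mat nr nc" "j < nc"
  shows "A *\<^sub>v unit_vec nc j = (col A j :: 'a::field vec)"
  using assms by (intro eq_vecI) auto

lemma mat_of_linear:
  fixes T :: "'a::field vec \<Rightarrow> 'a vec"
  assumes carrier: "\<And>v. v \<in> carrier_vec m \<Longrightarrow> T v \<in> carrier_vec m"
    and add: "\<And>v w. v \<in> carrier_vec m \<Longrightarrow> w \<in> carrier_vec m \<Longrightarrow> T (v + w) = T v + T w"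
    and smult: "\<And>c v. v \<in> carrier_vec m \<Longrightarrow> T (c \<cdot>\<^sub>v v) = c \<cdot>\<^sub>v T v"
  shows "\<exists>A\<in>carrier_mat m m. \<forall>v\<in>carrier_vec m. A *\<^sub>v v = T v"
proof -
  define A where "A = mat m m (\<lambda>(i, j). T (unit_vec m j) $ i)"
  have A: "A \<in> carrier_mat m m" by (simp add: A_def)
  have A_unit: "A *\<^sub>v unit_vec m j = T (unit_vec m j)" if "j < m" for j
    using that carrier[of "unit_vec m j"] mat_unit_vec_col[OF A that]
    by (auto simp: A_def intro!: eq_vecI)
  have "A *\<^sub>v v = T v" if "v \<in> lat UNIV m" for v
    using UNIV_I that
  proof (induction rule: lat_induct)
    case zero
    have "0 \<cdot>\<^sub>v 0\<^sub>v m = (0\<^sub>v m :: 'a vec)" by auto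
    then have "T (0\<^sub>v m) = 0 \<cdot>\<^sub>v T (0\<^sub>v m)" using smult[of "0\<^sub>v m" 0] by simp
    also have "\<dots> = 0\<^sub>v m" using carrier[of "0\<^sub>v m"] by auto
    finally show ?case using A by auto
  next
    case (step v c j)
    have v: "v \<in> carrier_vec m" using step(1) by (simp add: lat_UNIV)
    show ?case
      using step A v by (simp add: mult_add_distrib_mat_vec[OF A] mult_mat_vec[OF A] add smult A_unit)
  qed
  then show ?thesis using A by (auto simp: lat_UNIV)
qed

lemma mat_eq_on_lat:
  assumes "0 \<in> K" "1 \<in> K" "A \<in> carrier_mat m m" "B \<in> carrier_mat m m"
    and eq: "\<And>v. v \<in> lat K m \<Longrightarrow> A *\<^sub>v v = B *\<^sub>v v"
  shows "A = B"
proof (rule mat_col_eqI)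
  fix j assume "j < dim_col B"
  then have "j < m" using assms(4) by simp
  then show "col A j = col B j"
    using eq[OF unit_vec_lat[OF assms(1,2)], of j] mat_unit_vec_col assms(3,4) by metis
qed (use assms(3,4) in auto)

context adic_subring
begin

lemma kg_submod_diff:
  assumes N: "kg_submod K m A N" and "x \<in> N" "y \<in> N"
  shows "x - y \<in> N"
proof -
  have "(- 1) \<cdot>\<^sub>v y \<in> N" using assms uminus_closed[OF one_closed] by (simp add: kg_submod_def)
  then have "x + (- 1) \<cdot>\<^sub>v y \<in> N" using assms by (simp add: kg_submod_def)
  moreover have "x \<in> carrier_vec m" "y \<in> carrier_vec m"
    using assms by (auto simp: kg_submod_def lat_def)
  then have "x + (- 1) \<cdot>\<^sub>v y = x - y" by auto
  ultimately show ?thesis by simp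
qed

text \<open>A decomposition of the lattice yields the projection onto the first summand as a matrix
  over \<open>F\<close>, so that indecomposability becomes a question about idempotents.\<close>

lemma direct_sum_projection:
  assumes A: "A \<in> carrier_mat m m"
    and N1: "kg_submod K m A N1" and N2: "kg_submod K m A N2"
    and int: "N1 \<inter> N2 = {0\<^sub>v m}" and sum: "{x + y | x y. x \<in> N1 \<and> y \<in> N2} = lat K m"
  shows "\<exists>E\<in>carrier_mat m m. (\<forall>v\<in>lat K m. E *\<^sub>v v \<in> N1 \<and> v - E *\<^sub>v v \<in> N2)
    \<and> E * A = A * E \<and> E * E = E"
proof -
  have carr: "x \<in> carrier_vec m" if "x \<in> N1 \<or> x \<in> N2 \<or> x \<in> lat K m" for x
    using that N1 N2 by (auto simp: kg_submod_def lat_def)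
  have "\<exists>x. x \<in> N1 \<and> v - x \<in> N2" if v: "v \<in> lat K m" for v
  proof -
    obtain x y where xy: "x \<in> N1" "y \<in> N2" "v = x + y" using sum v by blast
    moreover from xy have "x \<in> carrier_vec m" "y \<in> carrier_vec m" using carr by blast+
    ultimately have "v - x = y" by auto
    then show ?thesis using xy by auto
  qed
  \<comment> \<open>\<open>f\<close> is a bare choice function; only its values on unit vectors
    enter \<open>E\<close>.\<close>
  then obtain f where f: "\<And>v. v \<in> lat K m \<Longrightarrow> f v \<in> N1" "\<And>v. v \<in> lat K m \<Longrightarrow> v - f v \<in> N2"
    by metis
  define E where "E = mat m m (\<lambda>(i, j). f (unit_vec m j) $ i)"
  have E: "E \<in> carrier_mat m m" by (simp add: E_def)
  note unit = unit_vec_lat[OF zero_closed one_closed]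
  have E_unit: "E *\<^sub>v unit_vec m j = f (unit_vec m j)" if "j < m" for j
  proof -
    have "f (unit_vec m j) \<in> carrier_vec m" using f(1)[OF unit] carr by blast
    then show ?thesis
      using that mat_unit_vec_col[OF E that] by (auto simp: E_def intro!: eq_vecI)
  qed
  have proj: "E *\<^sub>v v \<in> N1 \<and> v - E *\<^sub>v v \<in> N2" if "v \<in> lat K m" for v
    using zero_closed that
  proof (induction rule: lat_induct)
    case zero
    have "E *\<^sub>v 0\<^sub>v m = 0\<^sub>v m" using E by (intro eq_vecI) auto
    then show ?case using N1 N2 by (simp add: kg_submod_def)
  next
    case (step v c j)
    let ?u = "unit_vec m j"
    have v: "v \<in> carrier_vec m" using step by (simp add: lat_def)
    have fu: "f ?u \<in> carrier_vec m" using f(1)[OF unit] carr by blast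
    have Ev: "E *\<^sub>v v \<in> carrier_vec m" using E v by simp
    have 1: "E *\<^sub>v (v + c \<cdot>\<^sub>v ?u) = E *\<^sub>v v + c \<cdot>\<^sub>v f ?u"
      using E v step by (simp add: mult_add_distrib_mat_vec[OF E] mult_mat_vec[OF E] E_unit)
    have 2: "(v + c \<cdot>\<^sub>v ?u) - (E *\<^sub>v v + c \<cdot>\<^sub>v f ?u) = (v - E *\<^sub>v v) + c \<cdot>\<^sub>v (?u - f ?u)"
    proof -
      have "(a + c \<cdot>\<^sub>v u) - (b + c \<cdot>\<^sub>v d) = (a - b) + c \<cdot>\<^sub>v (u - d)"
        if "a \<in> carrier_vec m" "b \<in> carrier_vec m" "u \<in> carrier_vec m" "d \<in> carrier_vec m"
        for a b u d :: "'f vec"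
        using that by (auto simp: algebra_simps intro!: eq_vecI)
      then show ?thesis using v fu Ev by simp
    qed
    show ?case
      unfolding 1 2 using step f[OF unit] N1 N2 by (simp add: kg_submod_def)
  qed
  \<comment> \<open>Uniqueness of the \<open>N1\<close>-component reduces both matrix identities to
    membership in \<open>N1\<close> and \<open>N2\<close>.\<close>
  have uniq: "x = y" if "x \<in> N1" "y \<in> N1" "v - x \<in> N2" "v - y \<in> N2" "v \<in> lat K m" for v x y
  proof -
    have c: "x \<in> carrier_vec m" "y \<in> carrier_vec m" "v \<in> carrier_vec m" using that carr by auto
    have "(v - y) - (v - x) = x - y" using c by auto
    then have "x - y \<in> N1 \<inter> N2"
      using kg_submod_diff[OF N1 that(1,2)] kg_submod_diff[OF N2 that(4,3)] by simp
    then have xy: "x - y = 0\<^sub>v m" using int by simp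
    have "x = (x - y) + y" using c by auto
    then show ?thesis using xy c by simp
  qed
  have A_lat: "A *\<^sub>v v \<in> lat K m" if v: "v \<in> lat K m" for v
  proof -
    obtain x y where xy: "x \<in> N1" "y \<in> N2" "v = x + y" using sum v by blast
    then have "A *\<^sub>v v = A *\<^sub>v x + A *\<^sub>v y" using carr mult_add_distrib_mat_vec[OF A] by simp
    moreover have "A *\<^sub>v x \<in> N1" "A *\<^sub>v y \<in> N2" using xy N1 N2 by (auto simp: kg_submod_def)
    ultimately show ?thesis using sum by blast
  qed
  have "E * A = A * E"
  proof (rule mat_eq_on_lat[OF zero_closed one_closed])
    fix v assume v: "v \<in> lat K m"
    note vc = carr[OF disjI2[OF disjI2[OF v]]]
    have "A *\<^sub>v v - A *\<^sub>v (E *\<^sub>v v) = A *\<^sub>v (v - E *\<^sub>v v)"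
      using A E vc by (simp add: mult_minus_distrib_mat_vec)
    then have "A *\<^sub>v v - A *\<^sub>v (E *\<^sub>v v) \<in> N2" using proj[OF v] N2 by (simp add: kg_submod_def)
    moreover have "A *\<^sub>v (E *\<^sub>v v) \<in> N1" using proj[OF v] N1 by (simp add: kg_submod_def)
    ultimately have "E *\<^sub>v (A *\<^sub>v v) = A *\<^sub>v (E *\<^sub>v v)"
      using uniq[OF _ _ _ _ A_lat[OF v]] proj[OF A_lat[OF v]] by blast
    then show "(E * A) *\<^sub>v v = (A * E) *\<^sub>v v" using A E vc by simp
  qed (use A E in auto)
  moreover have "E * E = E"
  proof (rule mat_eq_on_lat[OF zero_closed one_closed])
    fix v assume v: "v \<in> lat K m"
    note vc = carr[OF disjI2[OF disjI2[OF v]]]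
    have Ev: "E *\<^sub>v v \<in> N1" "E *\<^sub>v v \<in> lat K m" using proj[OF v] N1 by (auto simp: kg_submod_def)
    have "E *\<^sub>v v \<in> carrier_vec m" using carr Ev by blast
    then have "E *\<^sub>v v - E *\<^sub>v v = 0\<^sub>v m" by auto
    then have "E *\<^sub>v v - E *\<^sub>v v \<in> N2" using N2 by (simp add: kg_submod_def)
    then have "E *\<^sub>v (E *\<^sub>v v) = E *\<^sub>v v" using uniq[OF _ Ev(1) _ _ Ev(2)] proj[OF Ev(2)] by blast
    then show "(E * E) *\<^sub>v v = E *\<^sub>v v" using E vc by simp
  qed (use E in auto)
  ultimately show ?thesis using E proj by blast
qed

end

text \<open>The gcd of k and p^s is a proper divisor of p^s, so it divides p^(s-1), and Bezout
  applies. Hence every nontrivial element of the group has a^(p^(s-1)) among its powers.\<close>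

lemma ex_multiple_mod_prime_power:
  assumes p: "prime (p::nat)" and k: "0 < k" "k < p ^ s"
  shows "\<exists>r t. r * k = p ^ (s - 1) + p ^ s * t"
proof -
  have s: "s > 0" using k by (cases s) auto
  have p1: "p > 1" using p prime_gt_1_nat by blast
  obtain i where i: "i \<le> s" "gcd k (p ^ s) = p ^ i" using divides_primepow_nat[OF p] gcd_dvd2 by blast
  have "p ^ i \<le> k" using i(2) k by (metis gcd_le1_nat less_irrefl)
  then have "i \<noteq> s" using k by auto
  then have "p ^ i dvd p ^ (s - 1)" using i(1) by (intro le_imp_power_dvd) simp
  then obtain d where d: "p ^ (s - 1) = p ^ i * d" by blast
  obtain x y where "k * x = p ^ s * y + gcd k (p ^ s)"
    using bezout_nat[of k "p ^ s"] k by auto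
  then have "d * x * k = p ^ (s - 1) + p ^ s * (d * y)"
    unfolding i(2) d by (simp add: algebra_simps)
  then show ?thesis by blast
qed

context glued_lattice
begin

section \<open>A basis of the glued lattice\<close>

definition idx_set :: "(nat \<times> nat \<times> nat) set" where
  "idx_set = (SIGMA l:{..<4}. {..<copies l} \<times> {..<degree (P l)})"

definition N :: nat where "N = card idx_set"

definition idx :: "nat \<Rightarrow> nat \<times> nat \<times> nat" where
  "idx = (SOME f. bij_betw f {..<N} idx_set)"

lemma finite_idx_set: "finite idx_set"
  by (simp add: idx_set_def)

lemma bij_idx: "bij_betw idx {..<N} idx_set"
  unfolding idx_def
  using someI_ex[OF ex_bij_betw_nat_finite[OF finite_idx_set]] by (simp add: N_def atLeast0LessThan)

text \<open>The constant coefficients on level 0 alone give \<open>n\<close> coordinates.\<close>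

lemma n_le_N: "n \<le> N"
proof -
  have "(\<lambda>j. (0, j, 0)) ` {..<n} \<subseteq> idx_set"
    using degree_P_pos by (auto simp: idx_set_def copies_def)
  then have "card ((\<lambda>j. (0::nat, j, 0::nat)) ` {..<n}) \<le> N"
    unfolding N_def by (rule card_mono[OF finite_idx_set])
  then show ?thesis by (simp add: card_image inj_on_def)
qed

text \<open>Coordinates with respect to a \<open>K\<close>-basis of \<open>M\<close>: the glueing congruences at levels 2 and 3
  are solved for the constant terms.\<close>

fun coord :: "(nat \<Rightarrow> nat \<Rightarrow> 'f poly) \<Rightarrow> nat \<times> nat \<times> nat \<Rightarrow> 'f" where
  "coord w (l, j, k) =
    (if k = 0 \<and> l = 2 then (coeff (w 2 j) 0 - coeff (w 0 j) 0 - coeff (w 1 j) 0) / of_nat p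
     else if k = 0 \<and> l = 3 then (coeff (w 3 j) 0 - coeff (w 0 j) 0 - coeff (w 1 (Suc j)) 0) / of_nat p
     else coeff (w l j) k)"

definition vec_of :: "(nat \<Rightarrow> nat \<Rightarrow> 'f poly) \<Rightarrow> 'f vec" where
  "vec_of w = vec N (\<lambda>r. coord w (idx r))"

lemma vec_of_carrier [simp]: "vec_of w \<in> carrier_vec N"
  by (simp add: vec_of_def)

lemma vec_of_add: "vec_of (w + v) = vec_of w + vec_of v"
proof -
  have "coord (w + v) x = coord w x + coord v x" for x
    by (cases x) (auto simp: field_simps)
  then show ?thesis by (auto simp: vec_of_def intro!: eq_vecI)
qed

lemma vec_of_diff: "vec_of (w - v) = vec_of w - vec_of v"
proof -
  have "coord (w - v) x = coord w x - coord v x" for x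
    by (cases x) (auto simp: field_simps)
  then show ?thesis by (auto simp: vec_of_def intro!: eq_vecI)
qed

lemma vec_of_0: "vec_of 0 = 0\<^sub>v N"
proof -
  have "coord 0 x = 0" for x by (cases x) simp
  then show ?thesis by (auto simp: vec_of_def intro!: eq_vecI)
qed

lemma vec_of_act_const: "w \<in> W \<Longrightarrow> vec_of (act [:c:] w) = c \<cdot>\<^sub>v vec_of w"
proof -
  assume w: "w \<in> W"
  have "coord (act [:c:] w) x = c * coord w x" for x
    by (cases x) (auto simp: act_const[OF w] field_simps)
  then show ?thesis by (auto simp: vec_of_def intro!: eq_vecI)
qed

lemma vec_of_eq_iff: "vec_of w = vec_of v \<longleftrightarrow> (\<forall>x\<in>idx_set. coord w x = coord v x)"
proof -
  have "vec_of w = vec_of v \<longleftrightarrow> (\<forall>r<N. coord w (idx r) = coord v (idx r))"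
    by (auto simp: vec_of_def vec_eq_iff)
  also have "\<dots> \<longleftrightarrow> (\<forall>x\<in>idx ` {..<N}. coord w x = coord v x)" by auto
  also have "idx ` {..<N} = idx_set" using bij_idx by (simp add: bij_betw_def)
  finally show ?thesis .
qed

lemma vec_of_inj:
  assumes "w \<in> W" "v \<in> W" "vec_of w = vec_of v"
  shows "w = v"
proof (intro ext)
  fix l j
  have c: "coord w (l, j, k) = coord v (l, j, k)" if "l < 4" "j < copies l" "k < degree (P l)" for l j k
    using assms(3) that unfolding vec_of_eq_iff idx_set_def by auto
  have c0: "coeff (w 0 j) 0 = coeff (v 0 j) 0" if "j < n" for j
    using c[of 0 j 0] that degree_P_pos by (simp add: copies_def)
  have c1: "coeff (w 1 j) 0 = coeff (v 1 j) 0" if "j \<le> n" for j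
    using c[of 1 j 0] that degree_P_pos by (simp add: copies_def)
  show "w l j = v l j"
  proof (cases "l < 4 \<and> j < copies l")
    case True
    have "coeff (w l j) k = coeff (v l j) k" if "k < degree (P l)" for k
    proof (cases "k = 0 \<and> (l = 2 \<or> l = 3)")
      case False
      then show ?thesis using c[of l j k] True that by (auto split: if_splits)
    next
      case True
      moreover from True have "j < n" using \<open>l < 4 \<and> j < copies l\<close> by (auto simp: copies_def)
      ultimately show ?thesis
        using c[of l j 0] that c0[of j] c1[of j] c1[of "Suc j"] \<open>l < 4 \<and> j < copies l\<close> by auto
    qed
    moreover have "coeff (w l j) k = coeff (v l j) k" if "\<not> k < degree (P l)" for k
      using that W_degree[OF assms(1), of l j] W_degree[OF assms(2), of l j] by (simp add: coeff_eq_0)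
    ultimately show ?thesis by (intro poly_eqI) blast
  next
    case False
    then show ?thesis using assms by (simp add: W_zero)
  qed
qed

lemma vec_of_surj:
  assumes u: "u \<in> carrier_vec N"
  obtains w where "w \<in> W" "vec_of w = u"
proof -
  define c where "c x = u $ (inv_into {..<N} idx x)" for x
  have c_idx: "c (idx r) = u $ r" if "r < N" for r
    using that bij_idx by (simp add: c_def bij_betw_def)
  \<comment> \<open>Inverts \<open>coord\<close>: constant terms on levels 2 and 3 are recovered
    from the glueing defect divided by p.\<close>
  define d where "d l j k = (if k = 0 \<and> l = 2 then c (0, j, 0) + c (1, j, 0) + of_nat p * c (2, j, 0)
    else if k = 0 \<and> l = 3 then c (0, j, 0) + c (1, Suc j, 0) + of_nat p * c (3, j, 0)
    else c (l, j, k))" for l j k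
  define w where "w l j = (if l < 4 \<and> j < copies l then (\<Sum>k<degree (P l). monom (d l j k) k) else 0)" for l j
  have cw: "coeff (w l j) k = (if l < 4 \<and> j < copies l \<and> k < degree (P l) then d l j k else 0)" for l j k
    by (auto simp: w_def coeff_sum)
  have "w \<in> W"
  proof (rule W_I)
    fix l j
    show "degree (w l j) < degree (P l)"
      by (intro degree_lessI) (use degree_P_pos in \<open>auto simp: cw\<close>)
  qed (auto simp: w_def)
  moreover have "vec_of w = u"
  proof (rule eq_vecI)
    fix r assume "r < dim_vec u"
    then have r: "r < N" using u by simp
    obtain l j k where x: "idx r = (l, j, k)" by (cases "idx r")
    have "(l, j, k) \<in> idx_set" using bij_idx r x by (metis bij_betw_apply lessThan_iff)
    then have ljk: "l < 4" "j < copies l" "k < degree (P l)" by (auto simp: idx_set_def)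
    have "coord w (l, j, k) = c (l, j, k)"
      using ljk degree_P_pos by (auto simp: cw d_def copies_def split: if_splits)
    then show "vec_of w $ r = u $ r" using r c_idx[OF r] by (simp add: vec_of_def x)
  qed (use u in \<open>simp add: vec_of_def\<close>)
  ultimately show thesis by (rule that)
qed

text \<open>Because \<open>coord\<close> divides the glueing defects by p, integrality of these
  coordinates is the glueing congruence. The constant terms on levels 2 and 3 are then integral as
  sums of integral terms.\<close>

lemma vec_of_lat_iff:
  assumes w: "w \<in> W"
  shows "vec_of w \<in> lat K N \<longleftrightarrow> w \<in> M"
proof -
  have "vec_of w \<in> lat K N \<longleftrightarrow> (\<forall>r<N. coord w (idx r) \<in> K)"
    by (auto simp: vec_of_def lat_def)
  also have "\<dots> \<longleftrightarrow> (\<forall>x\<in>idx ` {..<N}. coord w x \<in> K)" by auto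
  also have "\<dots> \<longleftrightarrow> (\<forall>x\<in>idx_set. coord w x \<in> K)" using bij_idx by (simp add: bij_betw_def)
  also have "\<dots> \<longleftrightarrow> w \<in> M"
  proof
    assume "w \<in> M"
    then have "coeff (w l j) k \<in> K" for l j k by (simp add: M_def L_def polys_over_def)
    then show "\<forall>x\<in>idx_set. coord w x \<in> K"
      using \<open>w \<in> M\<close> by (auto simp: idx_set_def M_def pK_iff copies_def split: if_splits)
  next
    assume "\<forall>x\<in>idx_set. coord w x \<in> K"
    then have c: "coord w (l, j, k) \<in> K" if "l < 4" "j < copies l" "k < degree (P l)" for l j k
      using that unfolding idx_set_def by auto
    have c0: "coeff (w 0 j) 0 \<in> K" if "j < n" for j
      using c[of 0 j 0] that degree_P_pos by (simp add: copies_def)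
    have c1: "coeff (w 1 j) 0 \<in> K" if "j \<le> n" for j
      using c[of 1 j 0] that degree_P_pos by (simp add: copies_def)
    have g2: "coeff (w 2 j) 0 - coeff (w 0 j) 0 - coeff (w 1 j) 0 \<in> pK" if "j < n" for j
      using c[of 2 j 0] that degree_P_pos by (simp add: copies_def pK_iff)
    have g3: "coeff (w 3 j) 0 - coeff (w 0 j) 0 - coeff (w 1 (Suc j)) 0 \<in> pK" if "j < n" for j
      using c[of 3 j 0] that degree_P_pos by (simp add: copies_def pK_iff)
    have c2: "coeff (w 2 j) 0 \<in> K" if "j < n" for j
      using add_closed[OF add_closed[OF pK_subset[OF g2[OF that]] c0[OF that]] c1[of j]] that by simp
    have c3: "coeff (w 3 j) 0 \<in> K" if "j < n" for j
      using add_closed[OF add_closed[OF pK_subset[OF g3[OF that]] c0[OF that]] c1[of "Suc j"]] that by simp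
    have "coeff (w l j) k \<in> K" for l j k
    proof (cases "l < 4 \<and> j < copies l \<and> k < degree (P l)")
      case True
      then consider "\<not> (k = 0 \<and> (l = 2 \<or> l = 3))" | "k = 0" "l = 2" "j < n" | "k = 0" "l = 3" "j < n"
        by (auto simp: copies_def split: if_splits)
      then show ?thesis
        by cases (use c[of l j k] True c2 c3 in \<open>auto split: if_splits\<close>)
    next
      case False
      then have "coeff (w l j) k = 0"
        using W_zero[OF w, of l j] W_degree[OF w, of l j] by (auto simp: coeff_eq_0)
      then show ?thesis by (simp add: zero_closed)
    qed
    then show "w \<in> M" using w g2 g3 by (simp add: M_def L_def polys_over_def)
  qed
  finally show ?thesis .
qed

section \<open>The matrix of the generator\<close>

definition gen :: "'f mat" where
  "gen = (SOME A. A \<in> carrier_mat N N \<and> (\<forall>w\<in>W. A *\<^sub>v vec_of w = vec_of (act z w)))"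

lemma gen_carrier [simp]: "gen \<in> carrier_mat N N"
  and gen_vec_of: "w \<in> W \<Longrightarrow> gen *\<^sub>v vec_of w = vec_of (act z w)"
proof -
  \<comment> \<open>Multiplication by \<open>z\<close> transported along the bijection
    \<open>vec_of\<close>.\<close>
  define T where "T u = vec_of (act z (THE w. w \<in> W \<and> vec_of w = u))" for u
  have T: "T (vec_of w) = vec_of (act z w)" if "w \<in> W" for w
  proof -
    have "(THE v. v \<in> W \<and> vec_of v = vec_of w) = w" using that vec_of_inj by blast
    then show ?thesis by (simp add: T_def)
  qed
  have "\<exists>A\<in>carrier_mat N N. \<forall>u\<in>carrier_vec N. A *\<^sub>v u = T u"
  proof (rule mat_of_linear)
    fix u v :: "'f vec" and c
    assume u: "u \<in> carrier_vec N"
    obtain w where w: "w \<in> W" "vec_of w = u" by (rule vec_of_surj[OF u])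
    show "T u \<in> carrier_vec N" by (simp add: T_def)
    have "T (c \<cdot>\<^sub>v u) = vec_of (act z (act [:c:] w))"
      using w T[OF act_W[OF w(1)], of "[:c:]"] by (simp add: vec_of_act_const)
    also have "\<dots> = vec_of (act [:c:] (act z w))" by (simp only: act_act mult.commute)
    also have "\<dots> = c \<cdot>\<^sub>v T u" using w T[OF w(1)] by (simp add: vec_of_act_const act_W)
    finally show "T (c \<cdot>\<^sub>v u) = c \<cdot>\<^sub>v T u" .
    assume v: "v \<in> carrier_vec N"
    obtain w' where w': "w' \<in> W" "vec_of w' = v" by (rule vec_of_surj[OF v])
    show "T (u + v) = T u + T v"
      using w w' T[OF w(1)] T[OF w'(1)] T[OF W_add[OF w(1) w'(1)]] by (simp add: vec_of_add act_add)
  qed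
  then have "\<exists>A. A \<in> carrier_mat N N \<and> (\<forall>w\<in>W. A *\<^sub>v vec_of w = vec_of (act z w))"
    using T vec_of_carrier by metis
  from someI_ex[OF this] show "gen \<in> carrier_mat N N"
    and "w \<in> W \<Longrightarrow> gen *\<^sub>v vec_of w = vec_of (act z w)" unfolding gen_def by blast+
qed

lemma gen_pow_vec_of: "w \<in> W \<Longrightarrow> gen ^\<^sub>m k *\<^sub>v vec_of w = vec_of (act (z ^ k) w)"
proof (induction k arbitrary: w)
  case 0
  then show ?case by (simp add: act_1 carrier_matD[OF gen_carrier])
next
  case (Suc k)
  have "gen ^\<^sub>m Suc k *\<^sub>v vec_of w = gen ^\<^sub>m k *\<^sub>v (gen *\<^sub>v vec_of w)"
    by (simp add: assoc_mult_mat_vec[of _ N N _ N])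
  also have "\<dots> = vec_of (act (z ^ k) (act z w))" using Suc by (simp add: gen_vec_of act_W)
  also have "\<dots> = vec_of (act (z ^ Suc k) w)" by (simp only: act_act power_Suc2)
  finally show ?case .
qed

lemma lat_obtain:
  assumes "v \<in> lat K N"
  obtains w where "w \<in> M" "vec_of w = v"
proof -
  have "v \<in> carrier_vec N" using assms by (simp add: lat_def)
  then obtain w where w: "w \<in> W" "vec_of w = v" by (rule vec_of_surj)
  then show thesis using that[of w] vec_of_lat_iff[OF w(1)] assms by simp
qed

lemma gen_cyc_lattice: "cyc_lattice K (p ^ s) N gen"
proof -
  note unit_lat = unit_vec_lat[OF zero_closed one_closed]
  have "gen $$ (i, j) \<in> K" if "i < N" "j < N" for i j
  proof -
    obtain w where w: "w \<in> M" "vec_of w = unit_vec N j" by (rule lat_obtain[OF unit_lat])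
    have "gen *\<^sub>v unit_vec N j = vec_of (act z w)" using w(2) gen_vec_of[OF L_W[OF M_L[OF w(1)]]] by simp
    then have "col gen j = vec_of (act z w)" using mat_unit_vec_col[OF gen_carrier that(2)] by simp
    moreover have "vec_of (act z w) \<in> lat K N"
      using vec_of_lat_iff M_act_z[OF w(1)] M_L L_W by blast
    ultimately have "col gen j \<in> lat K N" by simp
    then have "col gen j $ i \<in> K" using that by (simp add: lat_def)
    then show ?thesis using that carrier_matD[OF gen_carrier] by simp
  qed
  moreover have "gen ^\<^sub>m (p ^ s) = 1\<^sub>m N"
  proof (rule mat_eq_on_lat[OF zero_closed one_closed])
    fix v assume "v \<in> lat K N"
    then obtain w where w: "w \<in> M" "vec_of w = v" by (rule lat_obtain)
    have wW: "w \<in> W" using w(1) M_L L_W by blast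
    have "act (z ^ p ^ s) w = w"
      using act_cong[OF wW P_dvd_z_power] act_1[OF wW] by simp
    then show "gen ^\<^sub>m (p ^ s) *\<^sub>v v = 1\<^sub>m N *\<^sub>v v" using gen_pow_vec_of[OF wW] w(2)
      by (metis one_mult_mat_vec vec_of_carrier)
  qed auto
  ultimately show ?thesis by (simp add: cyc_lattice_def)
qed

text \<open>Tested on a unit vector of level s: a trivial power a^k with 0 < k < p^s would make
  a^(p^(s-1)) trivial there too, against \<open>P3_not_dvd\<close>.\<close>

lemma gen_cyc_faithful: "cyc_faithful (p ^ s) N gen"
  unfolding cyc_faithful_def
proof (intro allI impI notI)
  fix k assume k: "0 < k \<and> k < p ^ s" and eq: "gen ^\<^sub>m k = 1\<^sub>m N"
  have uL: "unit 3 0 \<in> L" using n_pos by (intro unit_L) (auto simp: copies_def)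
  note uW = L_W[OF uL]
  have "vec_of (act (z ^ k) (unit 3 0)) = vec_of (unit 3 0)"
    using gen_pow_vec_of[OF uW, of k] eq by simp
  then have "act (z ^ k) (unit 3 0) = unit 3 0" by (intro vec_of_inj act_W uW)
  then have "act (z ^ k) (unit 3 0) 3 0 = unit 3 0 3 0" by simp
  then have "z ^ k mod P 3 = 1" by (simp add: act_def unit_def)
  then have "z ^ k mod P 3 = 1 mod P 3" by (metis mod_mod_trivial)
  then have zk: "P 3 dvd z ^ k - 1" by (simp add: mod_eq_dvd_iff)
  have mult: "P 3 dvd z ^ (i * j) - 1" if "P 3 dvd z ^ i - 1" for i j
  proof -
    have "z ^ i - 1 dvd (z ^ i) ^ j - 1" by (simp add: power_diff_1_eq)
    then show ?thesis using that by (simp add: power_mult dvd_trans)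
  qed
  obtain r t where rt: "r * k = p ^ (s - 1) + p ^ s * t"
    using ex_multiple_mod_prime_power[OF prime_p] k by blast
  have "P 3 dvd z ^ (k * r) - 1" using mult[OF zk] .
  moreover have "P 3 dvd z ^ p ^ (s - 1) * (z ^ (p ^ s * t) - 1)"
    using mult[OF P_dvd_z_power] by simp
  ultimately have "P 3 dvd (z ^ (k * r) - 1) - z ^ p ^ (s - 1) * (z ^ (p ^ s * t) - 1)"
    by (rule dvd_diff)
  also have "\<dots> = z ^ p ^ (s - 1) - 1"
  proof -
    have "z ^ (k * r) = z ^ p ^ (s - 1) * z ^ (p ^ s * t)"
      by (simp only: mult.commute[of k r] rt power_add)
    moreover have "(a * b - 1) - a * (b - 1) = a - 1" for a b :: "'f poly"
      by (simp add: algebra_simps)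
    ultimately show ?thesis by metis
  qed
  finally show False using P3_not_dvd by blast
qed

text \<open>The projection of a decomposition becomes an idempotent endomorphism of
  \<open>M\<close>, hence 0 or 1 on \<open>L\<close>, and one summand vanishes.\<close>

lemma gen_indecomposable: "indecomposable K N gen"
proof -
  have False
    if N1: "kg_submod K N gen N1" and N2: "kg_submod K N gen N2"
      and ne: "N1 \<noteq> {0\<^sub>v N}" "N2 \<noteq> {0\<^sub>v N}" and int: "N1 \<inter> N2 = {0\<^sub>v N}"
      and sum: "{x + y | x y. x \<in> N1 \<and> y \<in> N2} = lat K N" for N1 N2
  proof -
    obtain E where E: "E \<in> carrier_mat N N"
      and proj: "\<And>v. v \<in> lat K N \<Longrightarrow> E *\<^sub>v v \<in> N1" "\<And>v. v \<in> lat K N \<Longrightarrow> v - E *\<^sub>v v \<in> N2"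
      and comm: "E * gen = gen * E" and idem: "E * E = E"
      using direct_sum_projection[OF gen_carrier N1 N2 int sum] by blast
    have "\<exists>e. \<forall>w. e w \<in> W \<and> vec_of (e w) = E *\<^sub>v vec_of w"
    proof (rule choice, rule allI)
      fix w
      have "E *\<^sub>v vec_of w \<in> carrier_vec N" using E by simp
      then show "\<exists>v. v \<in> W \<and> vec_of v = E *\<^sub>v vec_of w" using vec_of_surj by blast
    qed
    then obtain e where e: "\<And>w. e w \<in> W" "\<And>w. vec_of (e w) = E *\<^sub>v vec_of w" by blast
    have e_add: "e (w + v) = e w + e v" for w v
      by (intro vec_of_inj W_add e) (simp add: e(2) vec_of_add mult_add_distrib_mat_vec[OF E])
    have e_const: "e (act [:c:] w) = act [:c:] (e w)" if "w \<in> W" for c w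
      using that e by (intro vec_of_inj act_W) (simp_all add: vec_of_act_const mult_mat_vec[OF E])
    have e_z: "e (act z w) = act z (e w)" if "w \<in> W" for w
    proof (intro vec_of_inj act_W e)
      have "vec_of (e (act z w)) = (E * gen) *\<^sub>v vec_of w"
        using that by (simp add: e(2) assoc_mult_mat_vec[OF E gen_carrier] flip: gen_vec_of)
      also have "\<dots> = gen *\<^sub>v (E *\<^sub>v vec_of w)" unfolding comm by (rule assoc_mult_mat_vec[OF gen_carrier E vec_of_carrier])
      also have "\<dots> = vec_of (act z (e w))" using gen_vec_of[OF e(1)] e(2) by metis
      finally show "vec_of (e (act z w)) = vec_of (act z (e w))" .
    qed
    have e_act: "e (act g w) = act g (e w)" if "w \<in> W" for g w
      using that
    proof (induction g arbitrary: w)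
      case 0
      then show ?case using e_const[of w 0] by simp
    next
      case (pCons a g)
      \<comment> \<open>Compatibility is known only with constants and with \<open>z\<close>, so the
        leading factor t is written as \<open>z\<close> - 1.\<close>
      have "act (pCons a g) v = act [:a:] v + (act g (act z v) + act [:- 1:] (act g v))" for v
      proof -
        have "pCons a g = [:a:] + (g * z + [:- 1:] * g)" by simp
        then show ?thesis by (simp only: act_add_left act_act)
      qed
      then show ?case using pCons.prems by (simp only: e_add e_const act_W pCons.IH e_z e(1))
    qed
    have "endo e"
      unfolding endo_def
    proof (intro conjI ballI allI e e_add e_act)
      fix w assume "w \<in> M"
      then have "vec_of w \<in> lat K N" using vec_of_lat_iff M_L L_W by blast
      then have "vec_of (e w) \<in> lat K N" using proj(1) N1 e(2) by (auto simp: kg_submod_def)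
      then show "e w \<in> M" using vec_of_lat_iff[OF e(1)] by blast
    qed
    moreover have "e (e w) = e w" for w
    proof (intro vec_of_inj e)
      have "vec_of (e (e w)) = (E * E) *\<^sub>v vec_of w" using E by (simp add: e(2))
      then show "vec_of (e (e w)) = vec_of (e w)" by (simp add: idem e(2))
    qed
    ultimately consider "\<forall>w\<in>L. e w = 0" | "\<forall>w\<in>L. e w = w"
      using endo_idempotent_trivial by blast
    then show False
    proof cases
      case 1
      \<comment> \<open>With E = 0 the \<open>N2\<close>-component of \<open>v\<close> is
        \<open>v\<close> itself, so \<open>v\<close> lies in both summands.\<close>
      have "v = 0\<^sub>v N" if v: "v \<in> N1" for v
      proof -
        have lat: "v \<in> lat K N" using v N1 by (auto simp: kg_submod_def)
        then obtain w where w: "w \<in> M" "vec_of w = v" by (rule lat_obtain)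
        have "E *\<^sub>v v = 0\<^sub>v N" using 1 e(2)[of w] w M_L vec_of_0 by metis
        moreover have "v \<in> carrier_vec N" using w(2) by auto
        ultimately have "v \<in> N2" using proj(2)[OF lat] by simp
        then show ?thesis using v int by blast
      qed
      then show False using ne(1) N1 by (auto simp: kg_submod_def)
    next
      case 2
      have "v = 0\<^sub>v N" if v: "v \<in> N2" for v
      proof -
        have lat: "v \<in> lat K N" using v N2 by (auto simp: kg_submod_def)
        then obtain w where w: "w \<in> M" "vec_of w = v" by (rule lat_obtain)
        have "E *\<^sub>v v = v" using 2 e(2)[of w] w M_L by simp
        then have "v \<in> N1" using proj(1)[OF lat] by simp
        then show ?thesis using v int by blast
      qed
      then show False using ne(2) N2 by (auto simp: kg_submod_def)
    qed
  qed
  moreover have "0 < N" using n_le_N n_pos by simp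
  ultimately show ?thesis unfolding indecomposable_def by blast
qed

section \<open>The cocycle and its torsion-free extension\<close>

abbreviation inv_elt :: "'f \<Rightarrow> nat \<Rightarrow> nat \<Rightarrow> 'f poly" where
  "inv_elt c \<equiv> act [:c:] (unit 0 0)"

lemma unit00: "unit 0 0 \<in> L"
  using n_pos by (intro unit_L) (auto simp: copies_def)

lemma inv_elt_W: "inv_elt c \<in> W"
  using act_W L_W unit00 by blast

lemma inv_elt_eq: "inv_elt c = (\<lambda>l j. if l = 0 \<and> j = 0 then [:c:] else 0)"
  using n_pos by (intro act_const_unit) (auto simp: copies_def)

text \<open>The values are k p e / p^s with e the first unit vector of level 0. The multiple p e
  lies in \<open>M\<close>, but the value at k = p^(s-1) is e, which violates the glueing at level
  2.\<close>

definition tau :: "nat \<Rightarrow> 'f vec" where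
  "tau k = vec_of (inv_elt (of_nat k * of_nat p / of_nat (p ^ s)))"

lemma inv_elt_M: "c \<in> pK \<Longrightarrow> inv_elt c \<in> M"
proof (rule L0_M)
  assume c: "c \<in> pK"
  have "inv_elt c \<in> L" using L_act[OF unit00 const_over] c pK_subset by blast
  then show "inv_elt c \<in> L0" using c by (simp add: L0_def inv_elt_eq pK_zero)
qed

text \<open>Level 0 is taken modulo t = \<open>z\<close> - 1, so the group acts trivially on
  it.\<close>

lemma act_z_power_inv_elt: "act (z ^ k) (inv_elt c) = inv_elt c"
proof -
  have "P 0 dvd z ^ k - 1"
  proof -
    have "z - 1 dvd z ^ k - 1" by (simp only: power_diff_1_eq dvd_triv_left)
    then show ?thesis by (simp add: P_def one_pCons)
  qed
  then have "P 0 dvd (z ^ k - 1) * [:c:]" by (rule dvd_mult2)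
  then have "(z ^ k * [:c:]) mod P 0 = [:c:] mod P 0"
    by (simp only: mod_eq_dvd_iff left_diff_distrib mult_1)
  also have "\<dots> = [:c:]" using degree_P_pos[of 0] by (simp add: mod_poly_less)
  finally show ?thesis unfolding inv_elt_eq by (auto simp: act_def fun_eq_iff)
qed

text \<open>On invariant vectors the cocycle rule is additivity. Reducing k + l modulo p^s changes
  the value by a multiple of p e, which lies in \<open>M\<close>.\<close>

lemma tau_cocycle: "cocycle K (p ^ s) N gen tau"
  unfolding cocycle_def
proof (intro conjI allI impI)
  fix k l :: nat
  let ?q = "p ^ s" and ?f = "\<lambda>k. of_nat k * of_nat p / of_nat (p ^ s) :: 'f"
  have q0: "of_nat (p ^ s) \<noteq> (0 :: 'f)" by simp
  have add: "inv_elt (a + b) = inv_elt a + inv_elt b" "inv_elt (a - b) = inv_elt a - inv_elt b" for a b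
    unfolding inv_elt_eq by (auto simp: fun_eq_iff)
  have "tau ((k + l) mod ?q) - (gen ^\<^sub>m k *\<^sub>v tau l + tau k)
      = vec_of (inv_elt (?f ((k + l) mod ?q) - (?f l + ?f k)))"
    unfolding tau_def
    by (simp only: gen_pow_vec_of inv_elt_W act_z_power_inv_elt add vec_of_add vec_of_diff)
  also have "?f ((k + l) mod ?q) - (?f l + ?f k) = - (of_nat ((k + l) div ?q) * of_nat p)"
  proof -
    have "(of_nat (k + l) :: 'f) = of_nat ((k + l) div ?q * ?q + (k + l) mod ?q)"
      by (simp only: div_mult_mod_eq)
    then have "of_nat ((k + l) mod ?q) - (of_nat l + of_nat k) = - (of_nat ((k + l) div ?q) * of_nat ?q :: 'f)"
      by (simp only: of_nat_add of_nat_mult) (simp add: algebra_simps)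
    moreover have "?f ((k + l) mod ?q) - (?f l + ?f k)
        = (of_nat ((k + l) mod ?q) - (of_nat l + of_nat k)) * of_nat p / of_nat ?q"
      by (simp add: diff_divide_distrib add_divide_distrib algebra_simps)
    ultimately show ?thesis using q0 by (simp del: of_nat_power)
  qed
  also have "vec_of (inv_elt \<dots>) \<in> lat K N"
  proof -
    have "0 - of_nat ((k + l) div ?q) * of_nat p \<in> pK"
      by (intro pK_diff pK_mult pK_zero pK_p of_nat_closed)
    then show ?thesis using vec_of_lat_iff[OF inv_elt_W] inv_elt_M by simp
  qed
  finally show "tau ((k + l) mod ?q) - (gen ^\<^sub>m k *\<^sub>v tau l + tau k) \<in> lat K N" .
qed (simp add: tau_def)

lemma crys_pow_vec_of:
  assumes "y \<in> W"
  shows "crys_pow (p ^ s) N gen (k, vec_of y) m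
    = (m * k mod p ^ s, vec_of (act (\<Sum>i<m. (z ^ k) ^ i) y))"
proof (induction m)
  case 0
  have "act 0 y = 0" by (simp add: act_def fun_eq_iff)
  then have "vec_of (act 0 y) = 0\<^sub>v N" by (metis vec_of_0)
  then show ?case by simp
next
  case (Suc m)
  have "gen ^\<^sub>m k *\<^sub>v vec_of (act (\<Sum>i<m. (z ^ k) ^ i) y) + vec_of y
     = vec_of (act (z ^ k * (\<Sum>i<m. (z ^ k) ^ i) + 1) y)"
    by (simp only: gen_pow_vec_of act_W[OF assms] act_act act_add_left act_1[OF assms] vec_of_add)
  also have "z ^ k * (\<Sum>i<m. (z ^ k) ^ i) + 1 = (\<Sum>i<Suc m. (z ^ k) ^ i)"
    by (subst sum.lessThan_Suc_shift) (simp add: sum_distrib_left)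
  finally have "snd (crys_pow (p ^ s) N gen (k, vec_of y) (Suc m)) = vec_of (act (\<Sum>i<Suc m. (z ^ k) ^ i) y)"
    by (simp only: Suc crys_pow.simps crys_mult_def fst_conv snd_conv)
  moreover have "(m * k mod p ^ s + k) mod p ^ s = Suc m * k mod p ^ s"
    by (metis mod_add_left_eq add.commute mult_Suc)
  ultimately show ?case using Suc by (simp add: crys_mult_def)
qed

text \<open>A torsion element outside \<open>M\<close> has a power \<open>(a\<^sup>h, x)\<close> with \<open>h = p\<^sup>s\<^sup>-\<^sup>1\<close>. As \<open>a\<^sup>h\<close> is trivial on the
  levels 0, 1, 2, the vector \<open>x\<close> vanishes there, and subtracting the value of the cocycle leaves an
  element of \<open>M\<close> that violates the glueing condition at level 2.\<close>

lemma tau_torsion_free: "crys_torsion_free K (p ^ s) N gen tau"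
  unfolding crys_torsion_free_def
proof (intro ballI allI impI)
  fix e and m :: nat
  assume e: "e \<in> crys K (p ^ s) N tau" and m: "m > 0"
    and tors: "crys_pow (p ^ s) N gen e m = (0, 0\<^sub>v N)"
  obtain k x where kx: "e = (k, x)" "k < p ^ s" "x \<in> carrier_vec N" "x - tau k \<in> lat K N"
    using e by (auto simp: crys_def)
  obtain y where y: "y \<in> W" "vec_of y = x" by (rule vec_of_surj[OF kx(3)])
  let ?S = "\<lambda>k m. \<Sum>i<m. (z ^ k) ^ i"
  have "vec_of (act (?S k m) y) = vec_of 0"
    using tors crys_pow_vec_of[OF y(1), of k m] by (simp add: kx(1) vec_of_0 flip: y(2))
  then have Sy: "act (?S k m) y = 0" by (intro vec_of_inj act_W y W_0)
  show "e = (0, 0\<^sub>v N)"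
  proof (cases "k = 0")
    \<comment> \<open>A pure translation: its m-th power is m y, zero only for y = 0 in
      characteristic 0.\<close>
    case True
    then have "act [:of_nat m:] y = 0" using Sy by (simp add: of_nat_poly)
    then have "smult (of_nat m) (y l j) = 0" for l j
      using act_const[OF y(1), of "of_nat m"] by (metis zero_fun_apply)
    then have "y = 0" using m by (auto simp: fun_eq_iff)
    then show ?thesis using True kx(1) y(2) vec_of_0 by simp
  next
    case False
    then obtain r t where rt: "r * k = p ^ (s - 1) + p ^ s * t"
      using ex_multiple_mod_prime_power[OF prime_p] kx(2) by blast
    define v where "v = y - inv_elt (of_nat k * of_nat p / of_nat (p ^ s))"
    have vW: "v \<in> W" unfolding v_def by (intro W_diff y inv_elt_W)
    have "vec_of v = x - tau k" by (simp add: v_def vec_of_diff y(2) tau_def)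
    then have vM: "v \<in> M" using kx(4) vec_of_lat_iff[OF vW] by simp
    have S_over: "?S k r \<in> polys_over" by (intro polys_over_sum polys_over_power z_over)
    have M_act: "act g w \<in> M" if "w \<in> M" "g \<in> polys_over" for g w
      using that(2)
    proof (induction g)
      case 0
      have "act 0 w = act [:0:] w" by simp
      then show ?case using M_act_const[OF that(1) zero_closed] by metis
    next
      case (pCons a g)
      then have ag: "a \<in> K" "act g w \<in> M" by (simp_all add: polys_over_pCons)
      have "pCons a g = [:a:] + X * g" by simp
      then have "act (pCons a g) w = act [:a:] w + act X (act g w)" by (simp only: act_add_left act_act)
      then show ?case
        using M_add[OF M_act_const[OF that(1) ag(1)] L0_M[OF L0_act_X[OF M_L[OF ag(2)]]]] by metis
    qed
    \<comment> \<open>\<open>y'\<close> is the translation part of the r-th power of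
      \<open>e\<close>, which lies over a^(p^(s-1)); \<open>v'\<close> is the contribution of the
      \<open>M\<close>-part of x.\<close>
    define y' v' where "y' = act (?S k r) y" and "v' = act (?S k r) v"
    have v'M: "v' \<in> M" unfolding v'_def using M_act vM S_over by blast
    define c where "c = of_nat r * (of_nat k * of_nat p / of_nat (p ^ s) :: 'f)"
    have "act (?S k m) (inv_elt d) = inv_elt (of_nat m * d)" for m d
    proof (induction m)
      case 0
      show ?case by (simp add: act_def fun_eq_iff inv_elt_eq)
    next
      case (Suc m)
      have "act (?S k (Suc m)) (inv_elt d) = inv_elt (of_nat m * d) + inv_elt d"
        using Suc act_z_power_inv_elt by (simp add: act_add_left power_mult[symmetric])
      then show ?case by (simp add: inv_elt_eq fun_eq_iff algebra_simps)
    qed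
    then have y'_eq: "y' = inv_elt c + v'"
      unfolding y'_def v'_def c_def by (metis act_add diff_add_cancel v_def add.commute)
    \<comment> \<open>The level 0 contribution of the cocycle to \<open>y'\<close> is 1 modulo p,
      since r k p / p^s = 1 + p t.\<close>
    have c_eq: "c = 1 + of_nat p * of_nat t"
    proof -
      have ps: "(of_nat (p ^ s) :: 'f) = of_nat (p ^ (s - 1)) * of_nat p"
        using s_ge by (cases s) simp_all
      have "c = of_nat (r * k) * of_nat p / of_nat (p ^ s)" by (simp add: c_def)
      also have "\<dots> = (of_nat (p ^ (s - 1)) * of_nat p + of_nat (p ^ s) * of_nat t * of_nat p) / of_nat (p ^ s)"
        unfolding rt by (simp add: algebra_simps)
      also have "\<dots> = 1 + of_nat p * of_nat t"
        unfolding ps by (simp add: field_simps)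
      finally show ?thesis .
    qed
    \<comment> \<open>The two factorizations of the geometric sum with r m terms, that is, (e^r)^m =
      (e^m)^r. The factor \<open>z ^ k - 1\<close> is cancelled, being nonzero for k > 0.\<close>
    have geo: "?S (k * r) m * ?S k r = ?S (k * m) r * ?S k m"
    proof -
      have tele: "(z ^ k - 1) * (?S (k * i) j * ?S k i) = z ^ (k * i * j) - 1" for i j
      proof -
        have sum: "(z ^ h - 1) * ?S h j = z ^ (h * j) - 1" for h j
          by (subst power_mult) (rule power_diff_1_eq[symmetric])
        have "(z ^ k - 1) * (?S (k * i) j * ?S k i) = ((z ^ k - 1) * ?S k i) * ?S (k * i) j"
          by (simp only: mult_ac)
        also have "\<dots> = z ^ (k * i * j) - 1" by (simp only: sum)
        finally show ?thesis .
      qed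
      have "degree (z ^ k) = k" by (simp add: degree_linear_power)
      then have "z ^ k - 1 \<noteq> 0" using False by auto
      moreover have "(z ^ k - 1) * (?S (k * r) m * ?S k r) = (z ^ k - 1) * (?S (k * m) r * ?S k m)"
        unfolding tele by (simp add: mult_ac)
      ultimately show ?thesis using mult_left_cancel by blast
    qed
    have zero_act: "act g 0 = 0" for g by (simp add: act_def fun_eq_iff)
    have "act (?S (k * r) m) y' = act (?S (k * r) m * ?S k r) y" unfolding y'_def by (rule act_act)
    also have "\<dots> = act (?S (k * m) r) (act (?S k m) y)" unfolding geo by (rule act_act[symmetric])
    finally have kill: "act (?S (k * r) m) y' = 0" by (simp add: Sy zero_act)
    \<comment> \<open>On the levels 0, 1, 2 the power z^(kr) acts as 1, so the geometric sum acts as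
      m and forces \<open>y'\<close> to vanish.\<close>
    have y'_low: "y' l j = 0" if "l < 3" for l j
    proof -
      have dvd1: "P l dvd z ^ (k * r) - 1"
      proof -
        note P_dvd_z_power'[OF that]
        also have "z ^ p ^ (s - 1) - 1 dvd (z ^ p ^ (s - 1)) ^ (1 + p * t) - 1"
          by (subst power_diff_1_eq[of _ "1 + p * t"]) (rule dvd_triv_left)
        also have "(z ^ p ^ (s - 1)) ^ (1 + p * t) = z ^ (k * r)"
        proof -
          have "p ^ (s - 1) * (1 + p * t) = k * r"
            using rt s_ge by (cases s) (simp_all add: algebra_simps)
          then show ?thesis by (metis power_mult)
        qed
        finally show ?thesis .
      qed
      have "P l dvd ?S (k * r) m - of_nat m"
      proof -
        note dvd1
        also have "z ^ (k * r) - 1 dvd (\<Sum>i<m. (z ^ (k * r)) ^ i - 1)"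
          by (intro dvd_sum) (subst power_diff_1_eq, rule dvd_triv_left)
        also have "\<dots> = ?S (k * r) m - of_nat m" by (simp add: sum_subtractf)
        finally show ?thesis .
      qed
      then have "P l dvd (?S (k * r) m - of_nat m) * y' l j" by (rule dvd_mult2)
      then have "(?S (k * r) m * y' l j) mod P l = (of_nat m * y' l j) mod P l"
        by (simp only: mod_eq_dvd_iff left_diff_distrib)
      moreover have "(?S (k * r) m * y' l j) mod P l = 0"
        using kill by (metis act_def zero_fun_apply)
      ultimately have "(smult (of_nat m) (y' l j)) mod P l = 0" by (simp add: of_nat_poly)
      moreover have "y' l j mod P l = y' l j"
        unfolding y'_def by (rule mod_P_W[OF act_W[OF y(1)]])
      ultimately show ?thesis using m by (simp add: mod_smult_left)
    qed
    \<comment> \<open>So \<open>v'\<close> has -c on level 0 and 0 on levels 1 and 2 in its first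
      copies; the glueing at level 2 then demands c in \<open>pK\<close>, although c is 1 modulo
      p.\<close>
    have "[:c:] + v' 0 0 = 0" "v' 1 0 = 0" "v' 2 0 = 0"
      using y'_low[of 0 0] y'_low[of 1 0] y'_low[of 2 0] unfolding y'_eq
      by (simp_all add: inv_elt_eq)
    then have "v' 0 0 = - [:c:]" "v' 1 0 = 0" "v' 2 0 = 0"
      using minus_unique by metis+
    moreover have "coeff (v' 2 0) 0 - coeff (v' 0 0) 0 - coeff (v' 1 0) 0 \<in> pK"
      using v'M n_pos unfolding M_def by blast
    ultimately have "c \<in> pK" by simp
    moreover have "of_nat t * of_nat p \<in> pK" by (intro pK_mult of_nat_closed pK_p)
    ultimately have "c - of_nat t * of_nat p \<in> pK" by (rule pK_diff)
    then show ?thesis using one_notin_pK by (simp add: c_eq mult.commute)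
  qed
qed

end

theorem theorem1:
  fixes p s :: nat and K :: "'f::field_char_0 set"
  assumes "prime p" and "s \<ge> 3"
    and "K = \<int> \<or> K = zloc p \<or> is_padic_subring p K"
  shows "\<not> bdd_above {n. \<exists>A. cyc_lattice K (p ^ s) n A \<and> cyc_faithful (p ^ s) n A
            \<and> indecomposable K n A
            \<and> (\<exists>tau. cocycle K (p ^ s) n A tau \<and> crys_torsion_free K (p ^ s) n A tau)}"
proof
  assume "bdd_above {n. \<exists>A. cyc_lattice K (p ^ s) n A \<and> cyc_faithful (p ^ s) n A
            \<and> indecomposable K n A
            \<and> (\<exists>tau. cocycle K (p ^ s) n A tau \<and> crys_torsion_free K (p ^ s) n A tau)}"
    (is "bdd_above ?R")
  then obtain B where B: "\<And>n. n \<in> ?R \<Longrightarrow> n \<le> B" unfolding bdd_above_def by blast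
  have "adic_subring p K"
    using assms adic_subring_Ints adic_subring_zloc adic_subring_padic by blast
  \<comment> \<open>With B + 1 copies the rank \<open>N\<close> is at least B + 1, beyond the
    supposed bound.\<close>
  then interpret glued_lattice p K "Suc B" s
    using assms(2) by (simp add: glued_lattice_def glued_lattice_axioms_def)
  have "N \<in> ?R"
    using gen_cyc_lattice gen_cyc_faithful gen_indecomposable tau_cocycle tau_torsion_free by blast
  then show False using B n_le_N by fastforce
qed

end
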